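(* Let $\mathcal{G}$ and $\mathcal{G}'$ be substitution graphs with the same number of input nodes. Then $[\mathcal{G}]^{\mathbb{I}}=[\mathcal{G}']^{\mathbb{I}}$ if and only if $\mathcal{G}$ and $\mathcal{G}'$ are connected by a finite sequence of layer collapses, layer expansions, and node rewrites by $\mathcal{MV}$.
   Context: **Formulae.** A Łukasiewicz formula is a finite string built from propositional variables $x_1,x_2,\dots$ and constants $0,1$ with binary connectives $\oplus,\odot$ and unary $\lnot$. The truth function $\tau^{\mathbb{I}}:[0,1]^n\to[0,1]$ of a formula in (some of) $x_1,\dots,x_n$ is obtained by evaluating with $x\oplus y=\min\{1,x+y\}$, $x\odot y=\max\{0,x+y-1\}$, $\lnot x=1-x$ on $[0,1]$. A substitution $\zeta=\{x_{i_1}\mapsto\chi_1,\dots,x_{i_k}\mapsto\chi_k\}$ applied to $\tau$ gives $\tau(\zeta)$, obtained by simultaneously replacing every occurrence of each $x_{i_j}$ by $\chi_j$. **MV axioms** ($\mathcal{MV}$): $x\oplus y=y\oplus x$; $x\odot y=y\odot x$; $x\oplus(y\oplus z)=(x\oplus y)\oplus z$; $x\odot(y\odot z)=(x\odot y)\odot z$; $x\oplus\lnot x=1$; $x\odot\lnot x=0$; $x\oplus1=1$; $x\odot0=0$; $x\oplus0=x$; $x\odot1=x$; $\lnot(x\oplus y)=\lnot x\odot\lnot y$; $\lnot(x\odot y)=\lnot x\oplus\lnot y$; $x=\lnot(\lnot x)$; $\lnot0=1$; $(x\odot\lnot y)\oplus y=(y\odot\lnot x)\oplus x$; $(x\oplus\lnot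 y)\odot y=(y\oplus\lnot x)\odot x$. **Derivation step.** For an axiom $e$: $\epsilon=\epsilon'$, write $\tau\overset{e}{\sim}\tau'$ if $\tau'$ arises from $\tau$ by replacing one occurrence of a subformula $\gamma$ by $\gamma'$ where, for some substitution $\zeta$, $(\gamma,\gamma')=(\epsilon(\zeta),\epsilon'(\zeta))$ or $(\gamma,\gamma')=(\epsilon'(\zeta),\epsilon(\zeta))$. **Substitution graphs.** A layered graph of depth $L\ge1$ has levels $V^{(j)}=\{v^{(j)}_1,\dots,v^{(j)}_{d_j}\}$, $d_j\ge1$, $j=0,\dots,L$, $d_L=1$, $V^{(L)}=\{v_{\rm out}\}$, with edges exactly all pairs of nodes in consecutive levels. A substitution graph $\mathcal{G}$ is a layered graph with a formula $[v]$ at each node: input nodes carry $[v_i^{(0)}]=x_i$, and a level-$j$ node, $j\ge1$, carries a formula in the variables $x_1,\dots,x_{d_{j-1}}$ (the "level-$(j-1)$ variables"), $x_{i'}$ referring to the parent $v_{i'}^{(j-1)}$. Layer substitutions: $\zeta^{(j-1,j)}=\{x_{i'}\mapsto[v_{i'}^{(j-1)}]:i'=1,\dots,d_{j-1}\}$. The represented formula is $[\mathcal{G}]=[v_{\rm out}](\zeta^{(L-1,L)})(\zeta^{(L-2,L-1)})\cdots(\zeta^{(0,1)})$ (applied successively from left to right); $[\mathcal G]^{\mathbb I}$ is viewed as a function on $[0,1]^{d_0}$. **Node rewrite by a set of axioms $\mathcal{E}$.** Replace the formula $[v]$ of one non-input node $v$ at level $j$ by a formula $\tau'$ in the variables $x_1,\dots,x_{d_{j-1}}$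 with $[v]\overset{e}{\sim}\tau'$ for some $e\in\mathcal{E}$, leaving everything else unchanged. **Layer collapse.** For $L\ge2$ and $k\in\{1,\dots,L-1\}$: remove the level-$k$ nodes, join levels $k-1$ and $k+1$, and replace the formula $[v]$ of every level-$(k+1)$ node by $[v](\zeta^{(k,k+1)})$. **Layer expansion.** For $k\in\{1,\dots,L\}$: insert a new level of $m\ge1$ nodes between levels $k-1$ and $k$ (shifting levels $\ge k$ up by one); the inserted nodes carry formulae $\chi_1,\dots,\chi_m$ in the level-$(k-1)$ variables, and the formula $[v]$ of every node now at level $k+1$ is replaced by a formula $[v]'$ in $x_1,\dots,x_m$ with $[v]'(\{x_1\mapsto\chi_1,\dots,x_m\mapsto\chi_m\})=[v]$ (equality of strings); $m$, the $\chi_i$ and the $[v]'$ are free choices subject to this. *)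

theory Defs
  imports Complex_Main "HOL-Library.FuncSet"
begin

(* Formulae are syntax trees; equality of trees is equality of (uniquely readable) strings.
   Indices start at 0: Var i stands for the variable x_{i+1}. *)
datatype form =
    Var nat
  | Zero ("\<zero>")
  | One ("\<one>")
  | Oplus form form (infixl "\<oplus>" 65)
  | Odot form form (infixl "\<odot>" 70)
  | Neg form ("\<sim> _" [80] 80)

primrec fvars :: "form \<Rightarrow> nat set" where
  "fvars (Var i) = {i}"
| "fvars \<zero> = {}"
| "fvars \<one> = {}"
| "fvars (a \<oplus> b) = fvars a \<union> fvars b"
| "fvars (a \<odot> b) = fvars a \<union> fvars b"
| "fvars (\<sim> a) = fvars a"

primrec eval :: "(nat \<Rightarrow> real) \<Rightarrow> form \<Rightarrow> real" where
  "eval x (Var i) = x i"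
| "eval x \<zero> = 0"
| "eval x \<one> = 1"
| "eval x (a \<oplus> b) = min 1 (eval x a + eval x b)"
| "eval x (a \<odot> b) = max 0 (eval x a + eval x b - 1)"
| "eval x (\<sim> a) = 1 - eval x a"

(* The cube [0,1]^n is the set of extensional functions on {..<n}; restricting the truth
   function to it makes HOL equality of truth functions equality on the cube. *)
definition truth_fun :: "nat \<Rightarrow> form \<Rightarrow> (nat \<Rightarrow> real) \<Rightarrow> real" where
  "truth_fun n t = restrict (\<lambda>x. eval x t) ({..<n} \<rightarrow>\<^sub>E {0..1})"

(* Simultaneous substitution; variables that are not to be replaced are mapped to themselves. *)
primrec subst :: "(nat \<Rightarrow> form) \<Rightarrow> form \<Rightarrow> form" where
  "subst \<zeta> (Var i) = \<zeta> i"
| "subst \<zeta> \<zero> = \<zero>"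
| "subst \<zeta> \<one> = \<one>"
| "subst \<zeta> (a \<oplus> b) = subst \<zeta> a \<oplus> subst \<zeta> b"
| "subst \<zeta> (a \<odot> b) = subst \<zeta> a \<odot> subst \<zeta> b"
| "subst \<zeta> (\<sim> a) = \<sim> subst \<zeta> a"

definition list_subst :: "form list \<Rightarrow> nat \<Rightarrow> form" where
  "list_subst cs i = (if i < length cs then cs ! i else Var i)"

definition MV :: "(form \<times> form) set" where
  "MV = (let x = Var 0; y = Var 1; z = Var 2 in
    {(x \<oplus> y, y \<oplus> x),
     (x \<odot> y, y \<odot> x),
     (x \<oplus> (y \<oplus> z), (x \<oplus> y) \<oplus> z),
     (x \<odot> (y \<odot> z), (x \<odot> y) \<odot> z),
     (x \<oplus> \<sim> x, \<one>),
     (x \<odot> \<sim> x, \<zero>),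
     (x \<oplus> \<one>, \<one>),
     (x \<odot> \<zero>, \<zero>),
     (x \<oplus> \<zero>, x),
     (x \<odot> \<one>, x),
     (\<sim> (x \<oplus> y), \<sim> x \<odot> \<sim> y),
     (\<sim> (x \<odot> y), \<sim> x \<oplus> \<sim> y),
     (x, \<sim> (\<sim> x)),
     (\<sim> \<zero>, \<one>),
     ((x \<odot> \<sim> y) \<oplus> y, (y \<odot> \<sim> x) \<oplus> x),
     ((x \<oplus> \<sim> y) \<odot> y, (y \<oplus> \<sim> x) \<odot> x)})"

(* replace_one g g' t t': t' arises from t by replacing exactly one occurrence of g by g'. *)
inductive replace_one :: "form \<Rightarrow> form \<Rightarrow> form \<Rightarrow> form \<Rightarrow> bool" for g g' where
  here: "replace_one g g' g g'"
| oplus_left: "replace_one g g' a a' \<Longrightarrow> replace_one g g' (a \<oplus> b) (a' \<oplus> b)"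
| oplus_right: "replace_one g g' b b' \<Longrightarrow> replace_one g g' (a \<oplus> b) (a \<oplus> b')"
| odot_left: "replace_one g g' a a' \<Longrightarrow> replace_one g g' (a \<odot> b) (a' \<odot> b)"
| odot_right: "replace_one g g' b b' \<Longrightarrow> replace_one g g' (a \<odot> b) (a \<odot> b')"
| neg: "replace_one g g' a a' \<Longrightarrow> replace_one g g' (\<sim> a) (\<sim> a')"

definition deriv_step :: "form \<times> form \<Rightarrow> form \<Rightarrow> form \<Rightarrow> bool" where
  "deriv_step e t t' \<longleftrightarrow> (\<exists>g g' \<zeta>.
     ((g, g') = (subst \<zeta> (fst e), subst \<zeta> (snd e)) \<or>
      (g, g') = (subst \<zeta> (snd e), subst \<zeta> (fst e))) \<and>
     replace_one g g' t t')"

(* A substitution graph of depth L is the list of its levels 0, ..., L, each given by the list of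
   the formulae at its nodes. The edges are determined by the levels. *)
type_synonym sgraph = "form list list"

definition in_vars :: "nat \<Rightarrow> form \<Rightarrow> bool" where
  "in_vars n t \<longleftrightarrow> fvars t \<subseteq> {..<n}"

definition is_sgraph :: "sgraph \<Rightarrow> bool" where
  "is_sgraph G \<longleftrightarrow>
     length G \<ge> 2 \<and>
     (\<forall>j < length G. G ! j \<noteq> []) \<and>
     length (last G) = 1 \<and>
     G ! 0 = map Var [0..<length (G ! 0)] \<and>
     (\<forall>j \<in> {1..<length G}. \<forall>t \<in> set (G ! j). in_vars (length (G ! (j - 1))) t)"

definition num_inputs :: "sgraph \<Rightarrow> nat" where
  "num_inputs G = length (G ! 0)"

(* foldr applies the substitution of the last list element, i.e. of level L - 1, first. *)
definition sg_formula :: "sgraph \<Rightarrow> form" where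
  "sg_formula G = foldr (\<lambda>cs t. subst (list_subst cs) t) (butlast G) (hd (last G))"

definition sg_fun :: "sgraph \<Rightarrow> (nat \<Rightarrow> real) \<Rightarrow> real" where
  "sg_fun G = truth_fun (num_inputs G) (sg_formula G)"

definition node_rewrite :: "(form \<times> form) set \<Rightarrow> sgraph \<Rightarrow> sgraph \<Rightarrow> bool" where
  "node_rewrite E G G' \<longleftrightarrow> (\<exists>j \<in> {1..<length G}. \<exists>i < length (G ! j). \<exists>t'. \<exists>e \<in> E.
     deriv_step e (G ! j ! i) t' \<and>
     in_vars (length (G ! (j - 1))) t' \<and>
     G' = G[j := (G ! j)[i := t']])"

definition layer_collapse :: "sgraph \<Rightarrow> sgraph \<Rightarrow> bool" where
  "layer_collapse G G' \<longleftrightarrow> (\<exists>k \<ge> 1. k + 1 < length G \<and>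
     G' = take k G @ [map (subst (list_subst (G ! k))) (G ! (k + 1))] @ drop (k + 2) G)"

definition layer_expansion :: "sgraph \<Rightarrow> sgraph \<Rightarrow> bool" where
  "layer_expansion G G' \<longleftrightarrow> (\<exists>k \<in> {1..<length G}. \<exists>cs ts.
     cs \<noteq> [] \<and>
     (\<forall>c \<in> set cs. in_vars (length (G ! (k - 1))) c) \<and>
     (\<forall>t \<in> set ts. in_vars (length cs) t) \<and>
     map (subst (list_subst cs)) ts = G ! k \<and>
     G' = take k G @ [cs, ts] @ drop (k + 1) G)"

definition sg_move :: "(form \<times> form) set \<Rightarrow> sgraph \<Rightarrow> sgraph \<Rightarrow> bool" where
  "sg_move E G G' \<longleftrightarrow> layer_collapse G G' \<or> layer_expansion G G' \<or> node_rewrite E G G'"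

lemma in_vars_list_subst:
  assumes "in_vars (length cs) t" "\<forall>c \<in> set cs. in_vars n c"
  shows "in_vars n (subst (list_subst cs) t)"
  using assms by (induction t) (auto simp: in_vars_def list_subst_def)

(* The operations lead from substitution graphs to substitution graphs with the same inputs, so
   no well-formedness condition on intermediate graphs is needed. *)
lemma node_rewrite_is_sgraph:
  assumes "is_sgraph G" "node_rewrite E G G'"
  shows "is_sgraph G' \<and> num_inputs G' = num_inputs G"
proof -
  obtain j i t' where j: "1 \<le> j" "j < length G" "i < length (G ! j)"
    and t': "in_vars (length (G ! (j - 1))) t'" and G': "G' = G[j := (G ! j)[i := t']]"
    using assms(2) unfolding node_rewrite_def by auto
  have len: "length (G' ! l) = length (G ! l)" for l
    unfolding G' by (cases "l = j") (use j in auto)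
  have last: "length (last G') = length (last G)"
    using len[of "length G - 1"] j by (subst (1 2) last_conv_nth) (auto simp: G')
  have zero: "G' ! 0 = G ! 0"
    using j by (simp add: G')
  have "in_vars (length (G' ! (l - 1))) t" if "l \<in> {1..<length G}" "t \<in> set (G' ! l)" for l t
  proof (cases "l = j \<and> t = t'")
    case True
    then show ?thesis using t' len by simp
  next
    case False
    then have "t \<in> set (G ! l)"
      using that j set_update_subset_insert[of "G ! j" i t']
      by (cases "l = j") (auto simp: G')
    then show ?thesis using assms(1) that len by (simp add: is_sgraph_def)
  qed
  moreover have "G' ! l \<noteq> []" if "l < length G" for l
    using len[of l] assms(1) that by (metis is_sgraph_def length_0_conv)
  moreover have "length G' = length G" by (simp add: G')
  ultimately show ?thesis
    using assms(1) last zero by (simp add: is_sgraph_def num_inputs_def)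
qed

lemma layer_collapse_is_sgraph:
  assumes "is_sgraph G" "layer_collapse G G'"
  shows "is_sgraph G' \<and> num_inputs G' = num_inputs G"
proof -
  obtain k where k: "1 \<le> k" "k + 1 < length G"
    and G': "G' = take k G @ [map (subst (list_subst (G ! k))) (G ! (k + 1))] @ drop (k + 2) G"
    using assms(2) unfolding layer_collapse_def by auto
  have lenG: "length G' = length G - 1" using k by (simp add: G')
  have nth: "G' ! l = (if l < k then G ! l
      else if l = k then map (subst (list_subst (G ! k))) (G ! (k + 1)) else G ! (l + 1))"
    if "l < length G'" for l
  proof -
    consider "l < k" | "l = k" | m where "l = k + 1 + m"
      using less_imp_Suc_add[of k l] by fastforce
    then show ?thesis
      using k that by cases (auto simp: G' nth_append)
  qed
  have vars: "in_vars (length (G ! (j - 1))) t" if "j \<in> {1..<length G}" "t \<in> set (G ! j)" for j t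
    using assms(1) that unfolding is_sgraph_def by blast
  have "in_vars (length (G' ! (l - 1))) t" if l: "l \<in> {1..<length G'}" and t: "t \<in> set (G' ! l)" for l t
  proof -
    have nl: "G' ! (l - 1) = (if l - 1 < k then G ! (l - 1) else if l - 1 = k
        then map (subst (list_subst (G ! k))) (G ! (k + 1)) else G ! l)"
    proof -
      have "l - 1 < length G'" "l - 1 + 1 = l" using l by auto
      then show ?thesis using nth[of "l - 1"] by presburger
    qed
    consider "l < k" | "l = k" | "l = k + 1" | "l > k + 1" by linarith
    then show ?thesis
    proof cases
      case 2
      then obtain t0 where "t0 \<in> set (G ! (k + 1))" "t = subst (list_subst (G ! k)) t0"
        using nth[of l] l t by auto
      then show ?thesis
        using 2 k vars[of "k + 1" t0] vars[of k] nl by (auto intro!: in_vars_list_subst)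
    next
      case 3
      then show ?thesis using nth[of l] nl vars[of "l + 1" t] l t lenG by auto
    qed (use nth[of l] nl vars[of l t] vars[of "l + 1" t] l t lenG in auto)
  qed
  moreover have "G' ! l \<noteq> []" if "l < length G'" for l
    using nth[OF that] assms(1) that k lenG by (auto simp: is_sgraph_def)
  moreover have "length (last G') = length (last G)"
  proof (cases "k + 2 < length G")
    case False
    then have "k + 1 = length G - 1" "G \<noteq> []" using k by auto
    then have "last G = G ! (k + 1)" by (simp add: last_conv_nth)
    then show ?thesis using False by (simp add: G')
  qed (simp add: G')
  moreover have "G' ! 0 = G ! 0" using nth[of 0] k lenG by auto
  moreover have "length G' \<ge> 2" using k lenG by simp
  ultimately show ?thesis
    using assms(1) by (simp add: is_sgraph_def num_inputs_def)
qed

lemma layer_expansion_is_sgraph: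
  assumes "is_sgraph G" "layer_expansion G G'"
  shows "is_sgraph G' \<and> num_inputs G' = num_inputs G"
proof -
  obtain k cs ts where k: "1 \<le> k" "k < length G" and ne: "cs \<noteq> []"
    and cs: "\<forall>c \<in> set cs. in_vars (length (G ! (k - 1))) c"
    and ts: "\<forall>t \<in> set ts. in_vars (length cs) t"
    and eq: "map (subst (list_subst cs)) ts = G ! k"
    and G': "G' = take k G @ [cs, ts] @ drop (k + 1) G"
    using assms(2) unfolding layer_expansion_def by auto
  have lents: "length ts = length (G ! k)" using eq by (metis length_map)
  have lenG: "length G' = length G + 1" using k by (simp add: G')
  have nth: "G' ! l = (if l < k then G ! l else if l = k then cs else if l = k + 1 then ts
      else G ! (l - 1))" if "l < length G'" for l
  proof -
    consider "l < k" | "l = k" | "l = k + 1" | m where "l = k + 2 + m"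
      using less_imp_Suc_add[of "k + 1" l] by fastforce
    then show ?thesis
      using k that by cases (auto simp: G' nth_append)
  qed
  have vars: "in_vars (length (G ! (j - 1))) t" if "j \<in> {1..<length G}" "t \<in> set (G ! j)" for j t
    using assms(1) that unfolding is_sgraph_def by blast
  have "in_vars (length (G' ! (l - 1))) t" if l: "l \<in> {1..<length G'}" and t: "t \<in> set (G' ! l)" for l t
  proof -
    have nl: "G' ! (l - 1) = (if l - 1 < k then G ! (l - 1) else if l - 1 = k then cs
        else if l - 1 = k + 1 then ts else G ! (l - 1 - 1))"
      by (rule nth) (use l in auto)
    consider "l < k" | "l = k" | "l = k + 1" | "l = k + 2" | "l > k + 2" by linarith
    then show ?thesis
      by cases (use nth[of l] nl vars[of l t] vars[of "l - 1" t] l t lenG k cs ts lents in auto)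
  qed
  moreover have "G' ! l \<noteq> []" if "l < length G'" for l
    using nth[OF that] assms(1) that k lenG lents ne by (auto simp: is_sgraph_def)
  moreover have "length (last G') = length (last G)"
  proof (cases "k + 1 < length G")
    case False
    then have "k = length G - 1" "G \<noteq> []" using k by auto
    then have "last G = G ! k" by (simp add: last_conv_nth)
    then show ?thesis using lents False by (simp add: G')
  qed (simp add: G')
  moreover have "G' ! 0 = G ! 0" using nth[of 0] k lenG by auto
  moreover have "length G' \<ge> 2" using k lenG by simp
  ultimately show ?thesis
    using assms(1) by (simp add: is_sgraph_def num_inputs_def)
qed

end

theory Submission
  imports Defs "HOL-Library.Multiset" "HOL-Library.Product_Lexorder"
begin

text \<open>Every substitution graph collapses to depth 1, and each collapse is undone by an expansion, so the
  theorem reduces to Chang's completeness theorem: formulae with the same truth function are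
  derivable from each other by the MV axioms.

  For completeness, a valid formula that is not derivably equal to \<open>\<one>\<close> fails in a totally ordered
  quotient \<open>A\<close> of the Lindenbaum algebra, by a prime filter omitting it. Addition with carry makes
  \<open>\<nat> \<times> A\<close> an ordered cancellative monoid (the positive part of Chang's group), in which the values of
  the subformulae satisfy finitely many linear equations and inequalities with integer coefficients.
  By Fourier--Motzkin elimination these have a real solution, which is a valuation in \<open>[0, 1]\<close>
  where the formula fails.\<close>

section \<open>Finite parts of ordered cancellative monoids\<close>

text \<open>The quotient \<open>A\<close> need not be Archimedean, so in general it has no embedding
  into [0,1], and the counterexample cannot be carried over as a whole. Only the finitely many
  comparisons that fix the values of the subformulae are transferred. This succeeds because
  elimination uses nothing but addition, integer multiples and totality of the order. Strict
  inequalities have to survive it too: they keep the unit positive and the value of the failing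
  formula below the unit.

  Working with sums of nonnegative elements avoids constructing a group with inverses: it is enough
  that adding a common term preserves and reflects the order. The algebraic heart is then
  \<open>carry_add_commute\<close>, without which sums over multisets would have no meaning.

  On the side of graphs, collapses and expansions leave the represented formula unchanged as a
  string, so truth functions matter only for node rewrites.\<close>

lemma finite_bounds_separable:
  fixes l :: "'a \<Rightarrow> real" and u :: "'b \<Rightarrow> real"
  assumes "finite P" "finite Q"
    and sep: "\<And>a b. a \<in> P \<Longrightarrow> b \<in> Q \<Longrightarrow> l a \<le> u b \<and> (S a \<or> T b \<longrightarrow> l a < u b)"
  shows "\<exists>y. (\<forall>a\<in>P. l a \<le> y \<and> (S a \<longrightarrow> l a < y)) \<and> (\<forall>b\<in>Q. y \<le> u b \<and> (T b \<longrightarrow> y < u b))"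
proof -
  consider "P = {}" "Q = {}" | "P = {}" "Q \<noteq> {}" | "P \<noteq> {}" "Q = {}" | "P \<noteq> {}" "Q \<noteq> {}" by blast
  then show ?thesis
  proof cases
    case 2
    have "Min (u ` Q) - 1 < u b" if "b \<in> Q" for b
    proof -
      have "Min (u ` Q) \<le> u b" using assms(2) that by (intro Min_le) auto
      then show ?thesis by linarith
    qed
    then show ?thesis using 2 by (intro exI[of _ "Min (u ` Q) - 1"]) (auto intro: less_imp_le)
  next
    case 3
    have "l a < Max (l ` P) + 1" if "a \<in> P" for a
    proof -
      have "l a \<le> Max (l ` P)" using assms(1) that by (intro Max_ge) auto
      then show ?thesis by linarith
    qed
    then show ?thesis using 3 by (intro exI[of _ "Max (l ` P) + 1"]) (auto intro: less_imp_le)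
  next
    case 4
    have lo: "l a \<le> Max (l ` P)" if "a \<in> P" for a using assms that by simp
    have up: "Min (u ` Q) \<le> u b" if "b \<in> Q" for b using assms that by simp
    obtain a0 where a0: "a0 \<in> P" "l a0 = Max (l ` P)"
      using Max_in[of "l ` P"] assms 4 by fastforce
    obtain b0 where b0: "b0 \<in> Q" "u b0 = Min (u ` Q)"
      using Min_in[of "u ` Q"] assms 4 by fastforce
    \<comment> \<open>If the bound given by \<open>a\<close> is strict, it lies strictly below
      \<open>u b0\<close> and weakly below \<open>l a0\<close>, hence strictly below the midpoint;
      dually for upper bounds.\<close>
    have mid: "l a0 \<le> u b0" using sep a0(1) b0(1) by blast
    have "l a \<le> (l a0 + u b0) / 2 \<and> (S a \<longrightarrow> l a < (l a0 + u b0) / 2)" if "a \<in> P" for a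
      using lo[OF that] sep[OF that b0(1)] mid a0(2) by (auto simp: field_simps)
    moreover have "(l a0 + u b0) / 2 \<le> u b \<and> (T b \<longrightarrow> (l a0 + u b0) / 2 < u b)" if "b \<in> Q" for b
      using up[OF that] sep[OF a0(1) that] mid b0(2) by (auto simp: field_simps)
    ultimately show ?thesis by blast
  qed auto
qed

text \<open>A function \<open>c\<close> stands for an integer combination of elements of a totally
  ordered group. Both \<open>c\<close> and its negative may lie in the cone, which expresses a
  linear equation; strict positivity of \<open>c\<close> means that its negative does not lie
  there.\<close>

locale total_cone =
  fixes nonneg :: "('v \<Rightarrow> int) \<Rightarrow> bool"
  assumes nonneg_add: "nonneg c \<Longrightarrow> nonneg d \<Longrightarrow> nonneg (\<lambda>i. c i + d i)"
    and nonneg_total: "nonneg c \<or> nonneg (\<lambda>i. - c i)"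
begin

lemma nonneg_zero: "nonneg (\<lambda>i. 0)"
  using nonneg_total[of "\<lambda>i. 0"] by simp

lemma nonneg_nat_scale: "nonneg c \<Longrightarrow> nonneg (\<lambda>i. int n * c i)"
proof (induction n)
  case (Suc n)
  then show ?case using nonneg_add[of c "\<lambda>i. int n * c i"] by (simp add: algebra_simps)
qed (simp add: nonneg_zero)

lemma nonneg_scale: "nonneg c \<Longrightarrow> 0 \<le> k \<Longrightarrow> nonneg (\<lambda>i. k * c i)"
  using nonneg_nat_scale[of c "nat k"] by simp

text \<open>Totality replaces division: if \<open>c\<close> failed, its negative could be added
  \<open>k - 1\<close> times to \<open>k * c\<close>, which leaves \<open>c\<close>.\<close>

lemma nonneg_scaleD:
  assumes "nonneg (\<lambda>i. k * c i)" "0 < k"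
  shows "nonneg c"
proof (rule ccontr)
  assume "\<not> nonneg c"
  then have "nonneg (\<lambda>i. (k - 1) * - c i)"
    using nonneg_total[of c] nonneg_scale[of "\<lambda>i. - c i" "k - 1"] assms(2) by simp
  then have "nonneg (\<lambda>i. k * c i + (k - 1) * - c i)"
    using nonneg_add assms(1) by blast
  with \<open>\<not> nonneg c\<close> show False by (simp add: algebra_simps)
qed

text \<open>Cancelling one summand leaves the negative of a positive multiple of the other. Read
  contrapositively, a combination is strict as soon as one of its terms is, which carries strictness
  through the elimination.\<close>

lemma combination_strict:
  assumes "nonneg a" "nonneg b" "0 < p" "0 < q"
    and "nonneg (\<lambda>i. - (p * a i + q * b i))"
  shows "nonneg (\<lambda>i. - a i) \<and> nonneg (\<lambda>i. - b i)"
proof -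
  have "nonneg (\<lambda>i. - (p * a i + q * b i) + p * a i)" "nonneg (\<lambda>i. - (p * a i + q * b i) + q * b i)"
    using nonneg_add nonneg_scale assms by (metis less_imp_le)+
  then have "nonneg (\<lambda>i. q * - b i)" "nonneg (\<lambda>i. p * - a i)"
    by (simp_all add: algebra_simps)
  then show ?thesis using nonneg_scaleD assms by metis
qed

text \<open>Fourier--Motzkin elimination: a finite system of linear inequalities that is satisfied in the
  ordered group given by the cone is satisfied in the reals.\<close>

theorem real_representation:
  assumes "finite I" "finite F" "\<And>c i. c \<in> F \<Longrightarrow> i \<notin> I \<Longrightarrow> c i = 0"
  shows "\<exists>x. \<forall>c\<in>F. nonneg c \<longrightarrow> 0 \<le> (\<Sum>i\<in>I. real_of_int (c i) * x i) \<and>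
     (\<not> nonneg (\<lambda>i. - c i) \<longrightarrow> 0 < (\<Sum>i\<in>I. real_of_int (c i) * x i))"
  using assms
proof (induction I arbitrary: F rule: finite_induct)
  case empty
  then have "c = (\<lambda>i. 0)" if "c \<in> F" for c using that by auto
  then show ?case using nonneg_zero by fastforce
next
  case (insert j I)
  define P where "P = {a\<in>F. nonneg a \<and> 0 < a j}"
  define Q where "Q = {b\<in>F. nonneg b \<and> b j < 0}"
  \<comment> \<open>An inequality in \<open>P\<close> bounds coordinate \<open>j\<close> from below,
    one in \<open>Q\<close> from above. The weights \<open>- b j\<close> and \<open>a j\<close> are
    positive and make this coordinate cancel.\<close>
  define comb where "comb = (\<lambda>(a, b) i. (- b j) * a i + a j * b i :: int)"
  define F' where "F' = {c\<in>F. c j = 0} \<union> comb ` (P \<times> Q)"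
  have fin: "finite P" "finite Q" using insert.prems by (auto simp: P_def Q_def)
  have "finite F'" using fin insert.prems by (simp add: F'_def)
  moreover have "c i = 0" if "c \<in> F'" "i \<notin> I" for c i
  proof (cases "i = j")
    case False
    then have zero: "d i = 0" if "d \<in> F" for d using insert.prems(2) that \<open>i \<notin> I\<close> by blast
    have "comb (a, b) i = 0" if "a \<in> P" "b \<in> Q" for a b
      using that zero[of a] zero[of b] by (simp add: comb_def P_def Q_def)
    then show ?thesis using that(1) zero unfolding F'_def by blast
  qed (use that(1) in \<open>auto simp: F'_def comb_def\<close>)
  ultimately obtain x where x: "\<And>c. c \<in> F' \<Longrightarrow> nonneg c \<Longrightarrow> 0 \<le> (\<Sum>i\<in>I. real_of_int (c i) * x i) \<and>
     (\<not> nonneg (\<lambda>i. - c i) \<longrightarrow> 0 < (\<Sum>i\<in>I. real_of_int (c i) * x i))"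
    using insert.IH[of F'] by blast
  define s where "s c = (\<Sum>i\<in>I. real_of_int (c i) * x i)" for c :: "'v \<Rightarrow> int"
  define str where "str c = (\<not> nonneg (\<lambda>i. - c i))" for c
  have s_comb: "s (comb (a, b)) = (- b j) * s a + a j * s b" for a b
    by (simp add: s_def comb_def algebra_simps sum.distrib sum_distrib_left sum_subtractf sum_negf)
  have sep: "- s a / a j \<le> s b / (- b j) \<and> (str a \<or> str b \<longrightarrow> - s a / a j < s b / (- b j))"
    if a: "a \<in> P" and b: "b \<in> Q" for a b
  proof -
    have ab: "nonneg a" "nonneg b" "0 < a j" "0 < - b j" using a b by (auto simp: P_def Q_def)
    have "nonneg (comb (a, b))"
      using nonneg_add[OF nonneg_scale[of a "- b j"] nonneg_scale[of b "a j"]] ab by (simp add: comb_def)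
    moreover have "str (comb (a, b))" if "str a \<or> str b"
      using combination_strict[OF ab(1,2,4,3)] that by (auto simp: str_def comb_def)
    moreover have "comb (a, b) \<in> F'" using a b by (simp add: F'_def)
    ultimately have "0 \<le> s (comb (a, b)) \<and> (str a \<or> str b \<longrightarrow> 0 < s (comb (a, b)))"
      using x[of "comb (a, b)"] by (auto simp: s_def str_def)
    moreover have "0 < real_of_int (a j)" "real_of_int (b j) < 0" using ab by simp_all
    ultimately show ?thesis unfolding s_comb by (simp add: field_simps)
  qed
  obtain y where
    lo: "\<And>a. a \<in> P \<Longrightarrow> - s a / a j \<le> y \<and> (str a \<longrightarrow> - s a / a j < y)" and
    up: "\<And>b. b \<in> Q \<Longrightarrow> y \<le> s b / (- b j) \<and> (str b \<longrightarrow> y < s b / (- b j))"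
    using finite_bounds_separable[of P Q "\<lambda>a. - s a / a j" "\<lambda>b. s b / (- b j)" str str, OF fin sep] by blast
  have sum: "(\<Sum>i\<in>insert j I. real_of_int (c i) * (x(j := y)) i) = c j * y + s c" for c
  proof -
    have "(\<Sum>i\<in>I. real_of_int (c i) * (x(j := y)) i) = s c"
      unfolding s_def using insert.hyps by (intro sum.cong) auto
    then show ?thesis using insert.hyps by simp
  qed
  have "0 \<le> c j * y + s c \<and> (str c \<longrightarrow> 0 < c j * y + s c)" if c: "c \<in> F" "nonneg c" for c
  proof -
    consider "c j = 0" | "0 < c j" | "c j < 0" by linarith
    then show ?thesis
    proof cases
      case 1
      then show ?thesis using x[of c] c by (auto simp: F'_def s_def str_def)
    next
      case 2
      then have "0 < real_of_int (c j)" by simp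
      moreover have "c \<in> P" using 2 c by (simp add: P_def)
      ultimately show ?thesis using lo[of c] by (auto simp: field_simps)
    next
      case 3
      then have "real_of_int (c j) < 0" by simp
      moreover have "c \<in> Q" using 3 c by (simp add: Q_def)
      ultimately show ?thesis using up[of c] by (auto simp: field_simps)
    qed
  qed
  then show ?case unfolding str_def by (intro exI[of _ "x(j := y)"]) (simp only: sum, blast)
qed

end

text \<open>The cone consists of the differences of multisets over \<open>I\<close> on which \<open>val\<close> does not decrease.\<close>

theorem multiset_order_representation:
  fixes val :: "'v multiset \<Rightarrow> 'o::linorder"
  assumes val: "\<And>g M N. val (add_mset g N) \<le> val (add_mset g M) \<longleftrightarrow> val N \<le> val M"
    and "finite I" "finite \<M>" and sub: "\<And>M. M \<in> \<M> \<Longrightarrow> set_mset M \<subseteq> I"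
  shows "\<exists>x :: 'v \<Rightarrow> real. \<forall>M\<in>\<M>. \<forall>N\<in>\<M>. val N \<le> val M \<longleftrightarrow> (\<Sum>g\<in>#N. x g) \<le> (\<Sum>g\<in>#M. x g)"
proof -
  have val_add: "val (K + N) \<le> val (K + M) \<longleftrightarrow> val N \<le> val M" for K M N
    by (induction K) (simp_all add: val)
  have val_add_less: "val (K + N) < val (K + M) \<longleftrightarrow> val N < val M" for K M N
    using val_add[of K M N] by (simp add: not_le[symmetric])
  \<comment> \<open>The equation is demanded on \<open>I\<close> only: \<open>total_cone\<close>
    speaks of all functions, and one with infinite support is no difference of finite
    multisets.\<close>
  define rep where "rep c M N \<longleftrightarrow> set_mset M \<subseteq> I \<and> set_mset N \<subseteq> I \<and>
    (\<forall>i\<in>I. c i = int (count M i) - int (count N i))" for c M N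
  define nonneg where "nonneg c \<longleftrightarrow> (\<exists>M N. rep c M N \<and> val N \<le> val M)" for c
  have ex: "\<exists>M N. rep c M N" for c
  proof -
    define ms where "ms f = (\<Sum>i\<in>I. replicate_mset (f i) i)" for f :: "'v \<Rightarrow> nat"
    have count: "count (ms f) i = (if i \<in> I then f i else 0)" for f i
      using \<open>finite I\<close> by (simp add: ms_def count_sum)
    have "set_mset (ms f) \<subseteq> I" for f
      using count[of f] by (metis not_in_iff subsetI)
    then have "rep c (ms (\<lambda>i. nat (c i))) (ms (\<lambda>i. nat (- c i)))"
      by (auto simp: rep_def count)
    then show ?thesis by blast
  qed
  interpret total_cone nonneg
  proof
    fix c d assume "nonneg c" "nonneg d"
    then obtain M N M' N' where *: "rep c M N" "rep d M' N'" "val N \<le> val M" "val N' \<le> val M'"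
      unfolding nonneg_def by blast
    have "val (N + N') \<le> val (N + M')" using * val_add by blast
    also have "\<dots> \<le> val (M + M')" using * val_add[of M' N M] by (simp add: add.commute)
    finally have "val (N + N') \<le> val (M + M')" .
    moreover have "rep (\<lambda>i. c i + d i) (M + M') (N + N')"
      using * by (auto simp: rep_def)
    ultimately show "nonneg (\<lambda>i. c i + d i)" unfolding nonneg_def by blast
  next
    fix c
    obtain M N where "rep c M N" using ex by blast
    then have "rep (\<lambda>i. - c i) N M" by (auto simp: rep_def)
    with \<open>rep c M N\<close> show "nonneg c \<or> nonneg (\<lambda>i. - c i)"
      unfolding nonneg_def by (meson linear)
  qed
  have strict: "\<not> nonneg (\<lambda>i. - c i)" if "rep c M N" "val N < val M" for c M N
  proof
    assume "nonneg (\<lambda>i. - c i)"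
    then obtain M' N' where *: "rep (\<lambda>i. - c i) M' N'" "val N' \<le> val M'"
      unfolding nonneg_def by blast
    \<comment> \<open>Representations are not unique, so strictness must not depend on the choice.
      Opposite differences have equal cross sums \<open>M + M'\<close> and \<open>N + N'\<close>,
      whereas the comparisons below would make the second strictly smaller.\<close>
    have "M + M' = N + N'"
    proof (rule multiset_eqI)
      fix i
      show "count (M + M') i = count (N + N') i"
      proof (cases "i \<in> I")
        case True
        then have "c i = int (count M i) - int (count N i)" "- c i = int (count M' i) - int (count N' i)"
          using that(1) *(1) unfolding rep_def by blast+
        then show ?thesis by simp
      next
        case False
        then have "count K i = 0" if "K \<in> {M, N, M', N'}" for K
          using that \<open>rep c M N\<close> *(1) by (auto simp: rep_def count_eq_zero_iff)
        then show ?thesis by simp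
      qed
    qed
    moreover have "val (N + N') \<le> val (N + M')" using * val_add by blast
    moreover have "val (N + M') < val (M + M')"
      using that val_add_less[of M' N M] by (simp add: add.commute)
    ultimately show False by simp
  qed
  define diff where "diff = (\<lambda>(M :: 'v multiset, N) i. int (count M i) - int (count N i) :: int)"
  have rep_diff: "rep (diff (M, N)) M N" if "M \<in> \<M>" "N \<in> \<M>" for M N
    using that sub by (auto simp: rep_def diff_def)
  have "diff (M, N) i = 0" if "M \<in> \<M>" "N \<in> \<M>" "i \<notin> I" for M N i
    using that sub by (auto simp: diff_def) (metis count_eq_zero_iff in_mono)
  then have "\<exists>x. \<forall>c\<in>diff ` (\<M> \<times> \<M>). nonneg c \<longrightarrow> 0 \<le> (\<Sum>i\<in>I. real_of_int (c i) * x i) \<and>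
     (\<not> nonneg (\<lambda>i. - c i) \<longrightarrow> 0 < (\<Sum>i\<in>I. real_of_int (c i) * x i))"
    by (intro real_representation) (use assms in auto)
  then obtain x where x: "\<And>c. c \<in> diff ` (\<M> \<times> \<M>) \<Longrightarrow> nonneg c \<Longrightarrow> 0 \<le> (\<Sum>i\<in>I. real_of_int (c i) * x i) \<and>
     (\<not> nonneg (\<lambda>i. - c i) \<longrightarrow> 0 < (\<Sum>i\<in>I. real_of_int (c i) * x i))" by blast
  have "(\<Sum>i\<in>I. real (count M i) * x i) = (\<Sum>g\<in>#M. x g)" if "set_mset M \<subseteq> I" for M
    using that
  proof (induction M)
    case (add g M)
    have "(\<Sum>i\<in>I. real (count (add_mset g M) i) * x i) =
      (\<Sum>i\<in>I. (if i = g then x i else 0) + real (count M i) * x i)"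
      by (intro sum.cong) (auto simp: algebra_simps)
    also have "\<dots> = x g + (\<Sum>g\<in>#M. x g)"
      using add \<open>finite I\<close> by (simp add: sum.distrib)
    finally show ?case by simp
  qed simp
  then have sum: "(\<Sum>i\<in>I. real_of_int (diff (M, N) i) * x i) = (\<Sum>g\<in>#M. x g) - (\<Sum>g\<in>#N. x g)"
    if "M \<in> \<M>" "N \<in> \<M>" for M N
    using that sub by (simp add: diff_def left_diff_distrib sum_subtractf)
  have "val N \<le> val M \<longleftrightarrow> (\<Sum>g\<in>#N. x g) \<le> (\<Sum>g\<in>#M. x g)" if MN: "M \<in> \<M>" "N \<in> \<M>" for M N
  proof
    assume "val N \<le> val M"
    then have "nonneg (diff (M, N))" using rep_diff MN by (auto simp: nonneg_def)
    then show "(\<Sum>g\<in>#N. x g) \<le> (\<Sum>g\<in>#M. x g)" using x[of "diff (M, N)"] sum MN by auto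
  next
    assume le: "(\<Sum>g\<in>#N. x g) \<le> (\<Sum>g\<in>#M. x g)"
    show "val N \<le> val M"
    proof (rule ccontr)
      assume "\<not> val N \<le> val M"
      then have "val M < val N" by simp
      then have "nonneg (diff (N, M))" "\<not> nonneg (\<lambda>i. - diff (N, M) i)"
        using rep_diff[of N M] strict MN by (auto simp: nonneg_def intro: less_imp_le)
      then show False using x[of "diff (N, M)"] sum[of N M] le MN by auto
    qed
  qed
  then show ?thesis by blast
qed

section \<open>MV-algebras and prime filters\<close>

text \<open>There is no distributive law, so only the two monoid classes are inherited; the
  multiplicative one also provides powers. \<open>- x + y\<close> is implication,
  \<open>x * - y + y\<close> is the join of \<open>x\<close> and \<open>y\<close>, and
  \<open>lukasiewicz\<close> is its symmetry.\<close>

class mv_algebra = comm_monoid_add + comm_monoid_mult + uminus + ord +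
  assumes add_one [simp]: "x + 1 = 1"
    and add_neg [simp]: "x + - x = 1"
    and neg_neg [simp]: "- (- x) = x"
    and neg_add: "- (x + y) = - x * - y"
    and neg_zero [simp]: "- 0 = 1"
    and lukasiewicz: "x * - y + y = y * - x + x"
    and le_iff_imp: "x \<le> y \<longleftrightarrow> - x + y = 1"
    and less_iff: "x < y \<longleftrightarrow> x \<le> y \<and> \<not> y \<le> x"
begin

lemma one_add [simp]: "1 + x = 1"
  using add_one[of x] by (simp add: add.commute)

lemma neg_mult: "- (x * y) = - x + - y"
  by (metis neg_add neg_neg)

lemma neg_one [simp]: "- 1 = 0"
  by (metis neg_neg neg_zero)

lemma mult_neg [simp]: "x * - x = 0"
  by (metis add_neg neg_add neg_neg neg_one)

lemma mult_zero [simp]: "x * 0 = 0" "0 * x = 0"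
  by (metis add_one neg_mult neg_neg neg_one neg_zero mult.commute)+

lemma le_iff_mult_neg: "x \<le> y \<longleftrightarrow> x * - y = 0"
  by (metis le_iff_imp neg_mult neg_neg neg_one neg_zero)

lemma le_iff_add: "x \<le> y \<longleftrightarrow> (\<exists>z. y = x + z)"
proof
  assume "x \<le> y"
  then have "y = x * - y + y" by (simp add: le_iff_mult_neg)
  then have "y = x + y * - x" by (metis lukasiewicz add.commute)
  then show "\<exists>z. y = x + z" ..
next
  assume "\<exists>z. y = x + z"
  then obtain z where "y = x + z" ..
  then have "- x + y = (x + - x) + z" by (simp only: ac_simps)
  then show "x \<le> y" by (simp only: le_iff_imp add_neg one_add)
qed

subclass order
proof
  show "x \<le> z" if "x \<le> y" "y \<le> z" for x y z
    using that by (metis le_iff_add add.assoc)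
  show "x = y" if "x \<le> y" "y \<le> x" for x y
    using that lukasiewicz[of x y] by (simp add: le_iff_mult_neg)
qed (simp_all add: less_iff le_iff_imp add.commute)

lemma zero_le [simp]: "0 \<le> x"
  by (simp add: le_iff_imp)

lemma le_one [simp]: "x \<le> 1"
  by (simp add: le_iff_imp)

lemma one_le_iff [simp]: "1 \<le> x \<longleftrightarrow> x = 1"
  by (simp add: le_iff_imp)

lemma le_zero_iff [simp]: "x \<le> 0 \<longleftrightarrow> x = 0"
  by (simp add: le_iff_mult_neg)

lemma neg_le_neg [simp]: "- x \<le> - y \<longleftrightarrow> y \<le> x"
  by (simp add: le_iff_imp add.commute)

lemma add_right_mono': "x \<le> y \<Longrightarrow> x + z \<le> y + z"
  by (metis le_iff_add add.assoc add.commute)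

lemma add_mono': "x \<le> y \<Longrightarrow> z \<le> w \<Longrightarrow> x + z \<le> y + w"
  by (metis add_right_mono' add.commute order.trans)

lemma mult_mono': "x \<le> y \<Longrightarrow> z \<le> w \<Longrightarrow> x * z \<le> y * w"
  by (metis add_mono' neg_le_neg neg_mult)

lemma le_add [simp]: "x \<le> x + y" "x \<le> y + x"
  by (metis le_iff_add add.commute)+

lemma mult_le [simp]: "x * y \<le> x" "y * x \<le> x"
  by (metis le_add neg_le_neg neg_mult)+

lemma mult_eq_one: "x * y = 1 \<Longrightarrow> x = 1"
  using mult_le(1)[of x y] by simp

text \<open>Residuation, the algebraic deduction theorem: by associativity both sides say that the
  same sum is \<open>1\<close>.\<close>

lemma mult_le_iff: "x * y \<le> z \<longleftrightarrow> x \<le> - y + z"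
  by (simp add: le_iff_imp neg_mult add.assoc)

lemma neg_le_iff: "- x \<le> y \<longleftrightarrow> x + y = 1"
  by (simp add: le_iff_imp)

lemma le_neg_iff: "x \<le> - y \<longleftrightarrow> x * y = 0"
  by (simp add: le_iff_mult_neg)

lemma mult_imp_le: "x * (- x + y) \<le> y"
  by (metis mult_le_iff order.refl mult.commute add.commute neg_neg)

text \<open>The join with a smaller element changes nothing. Here this acts as cancellation: adding
  \<open>y\<close> undoes truncated subtraction of \<open>y\<close>, and the dual
  \<open>add_mult_neg_absorb\<close> undoes an addition.\<close>

lemma mult_neg_add_absorb: "y \<le> x \<Longrightarrow> x * - y + y = x"
  using lukasiewicz[of x y] by (simp add: le_iff_mult_neg)

lemma add_mult_neg_absorb: "x \<le> y \<Longrightarrow> (x + - y) * y = x"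
  by (metis mult_neg_add_absorb[of "- y" "- x"] neg_add neg_le_neg neg_neg)

lemma lukasiewicz_dual: "(x + - y) * y = (y + - x) * x"
  by (metis lukasiewicz[of "- y" "- x"] lukasiewicz[of "- x" "- y"] neg_add neg_mult neg_neg)

lemma join_least:
  assumes "x \<le> z" "y \<le> z"
  shows "x * - y + y \<le> z"
  by (metis add_right_mono' assms mult_mono' mult_neg_add_absorb order.refl)

text \<open>\<open>x * - y\<close> is truncated subtraction and \<open>a * (- a + b)\<close> is the
  meet of \<open>a\<close> and \<open>b\<close>: the differences in the two directions are disjoint.
  On a chain this would be immediate, but it is needed to obtain chains in the first place. The
  proof shifts factors by the symmetry of the meet.\<close>

lemma meet_imp_zero: "(x * - y) * (- (x * - y) + y * - x) = 0"
proof -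
  define w where "w = - (x * - y) + y * - x"
  have "(x * - y) * w \<le> y * - x"
    unfolding w_def by (rule mult_imp_le)
  define p where "p = - x + y * - x"
  have w: "w = y + p"
    by (simp add: w_def p_def neg_mult ac_simps)
  have "- y * (y + p) = p * (- p + - y)"
    using lukasiewicz_dual[of p "- y"] by (simp add: ac_simps)
  then have "(x * - y) * w = (x * p) * (- p + - y)"
    by (simp add: w mult.assoc)
  also have "x * p = (y * - x) * (- (y * - x) + x)"
    using lukasiewicz_dual[of "y * - x" x] by (simp add: p_def ac_simps)
  also have "- p = x * (- y + x)"
    by (simp add: p_def neg_add neg_mult)
  also have "(y * - x) * (- (y * - x) + x) * (x * (- y + x) + - y)
     = (- (y * - x) + x) * (- x * (y * (- y + x * (- y + x))))"
    by (simp only: ac_simps)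
  \<comment> \<open>\<open>y * (- y + x * (- y + x))\<close> is a meet, so it lies below
    \<open>x * (- y + x)\<close> and hence below \<open>x\<close>.\<close>
  also have "\<dots> \<le> - x * x"
    by (meson mult_imp_le mult_le mult_mono' order.refl order.trans)
  finally show ?thesis by (simp add: mult.commute w_def)
qed

lemma prelinear:
  assumes "- x + y \<le> z" "- y + x \<le> z"
  shows "z = 1"
proof -
  have "(- x + y) * - (- y + x) + (- y + x) \<le> z"
    using assms by (rule join_least)
  moreover have "- ((- x + y) * - (- y + x) + (- y + x)) = 0"
    using meet_imp_zero[of y x] by (simp add: neg_add neg_mult ac_simps)
  then have "(- x + y) * - (- y + x) + (- y + x) = 1"
    by (metis neg_neg neg_zero)
  ultimately show ?thesis by simp
qed

text \<open>If the join of \<open>u\<close> and \<open>v\<close> is \<open>1\<close>, so is that of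
  \<open>u\<close> and a power of \<open>v\<close>; the join is expressed through its upper bounds.
  Residuation moves all factors \<open>v\<close> but one to the right, which gives a common upper
  bound of \<open>u\<close> and \<open>v\<close>.\<close>

lemma join_one_power:
  assumes "\<And>z. u \<le> z \<Longrightarrow> v \<le> z \<Longrightarrow> z = 1" "u \<le> z" "v ^ n \<le> z"
  shows "z = 1"
  using assms(3)
proof (induction n)
  case (Suc n)
  have "v \<le> - (v ^ n) + z" using Suc.prems by (simp add: mult_le_iff)
  moreover have "u \<le> - (v ^ n) + z" using assms(2) le_add order.trans by blast
  ultimately have "v ^ n \<le> z" using assms(1) unfolding le_iff_imp by blast
  then show ?case by (rule Suc.IH)
qed simp

lemma prelinear_power:
  assumes "(- x + y) ^ m \<le> z" "(- y + x) ^ n \<le> z"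
  shows "z = 1"
proof -
  have "z = 1" if "(- x + y) ^ m \<le> z" "- y + x \<le> z" for z
    using join_one_power[of "- y + x" "- x + y" z m] prelinear[of x y] that by blast
  then show ?thesis
    using join_one_power[of "(- x + y) ^ m" "- y + x" z n] assms by blast
qed

section \<open>Deductive and prime filters\<close>

definition deductive :: "'a set \<Rightarrow> bool" where
  "deductive F \<longleftrightarrow> 1 \<in> F \<and> (\<forall>a b. a \<in> F \<longrightarrow> - a + b \<in> F \<longrightarrow> b \<in> F)"

text \<open>In this form, primeness is exactly totality of the order on the quotient.\<close>

definition prime :: "'a set \<Rightarrow> bool" where
  "prime F \<longleftrightarrow> (\<forall>a b. - a + b \<in> F \<or> - b + a \<in> F)"

lemma deductive_mp: "deductive F \<Longrightarrow> a \<in> F \<Longrightarrow> - a + b \<in> F \<Longrightarrow> b \<in> F"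
  unfolding deductive_def by blast

lemma deductive_one: "deductive F \<Longrightarrow> 1 \<in> F"
  unfolding deductive_def by blast

lemma deductive_upward: "deductive F \<Longrightarrow> a \<in> F \<Longrightarrow> a \<le> b \<Longrightarrow> b \<in> F"
  using deductive_mp[of F a b] deductive_one[of F] unfolding le_iff_imp by metis

lemma deductive_mult:
  assumes "deductive F" "a \<in> F" "b \<in> F" "a * b \<le> c"
  shows "c \<in> F"
proof -
  have "b * a \<le> c" using assms(4) by (simp only: mult.commute)
  then have "b \<le> - a + c" by (simp only: mult_le_iff)
  then have "- a + c \<in> F" using assms deductive_upward by blast
  then show ?thesis using assms deductive_mp by blast
qed

text \<open>This is the filter generated by \<open>F\<close> and \<open>u\<close>. A deduction may
  use \<open>u\<close> repeatedly, hence the powers; modus ponens adds their exponents.\<close>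

lemma deductive_adjoin:
  assumes F: "deductive F"
  shows "deductive {c. \<exists>n. - (u ^ n) + c \<in> F}"
proof -
  have "- (u ^ (n + m)) + b \<in> F" if "- (u ^ n) + a \<in> F" "- (u ^ m) + (- a + b) \<in> F" for a b m n
  proof (rule deductive_mult[OF F that])
    have "((- (u ^ n) + a) * (- (u ^ m) + (- a + b))) * u ^ (n + m)
      = (u ^ n * (- (u ^ n) + a)) * (u ^ m * (- (u ^ m) + (- a + b)))"
      by (simp only: power_add ac_simps)
    also have "\<dots> \<le> a * (- a + b)"
      by (intro mult_mono' mult_imp_le)
    also have "\<dots> \<le> b" by (rule mult_imp_le)
    finally show "(- (u ^ n) + a) * (- (u ^ m) + (- a + b)) \<le> - (u ^ (n + m)) + b"
      by (simp add: mult_le_iff)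
  qed
  then have "\<exists>n. - (u ^ n) + b \<in> F"
    if "\<exists>n. - (u ^ n) + a \<in> F" "\<exists>n. - (u ^ n) + (- a + b) \<in> F" for a b
    using that by blast
  moreover have "- (u ^ 0) + 1 \<in> F" using deductive_one[OF F] by simp
  then have "\<exists>n. - (u ^ n) + 1 \<in> F" ..
  ultimately show ?thesis unfolding deductive_def mem_Collect_eq by blast
qed

text \<open>Zorn's lemma gives a filter maximal among those omitting \<open>d\<close>. If it
  contained neither implication between \<open>a\<close> and \<open>b\<close>, adjoining either one
  would produce \<open>d\<close> from a power of it, although by prelinearity such powers have no
  common upper bound but \<open>1\<close>.\<close>

lemma ex_prime_deductive:
  assumes "d \<noteq> 1"
  shows "\<exists>F. deductive F \<and> prime F \<and> d \<notin> F"
proof -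
  let ?\<F> = "{F. deductive F \<and> d \<notin> F}"
  have "{1} \<in> ?\<F>" using assms unfolding deductive_def by simp
  moreover have "\<Union>\<C> \<in> ?\<F>" if "\<C> \<noteq> {}" "subset.chain ?\<F> \<C>" for \<C>
  proof -
    have mp: "b \<in> \<Union>\<C>" if "a \<in> \<Union>\<C>" "- a + b \<in> \<Union>\<C>" for a b
    proof -
      from that obtain F F' where "F \<in> \<C>" "F' \<in> \<C>" "a \<in> F" "- a + b \<in> F'" by blast
      moreover from this have "F \<subseteq> F' \<or> F' \<subseteq> F"
        using \<open>subset.chain ?\<F> \<C>\<close> unfolding subset_chain_def by blast
      ultimately obtain K where K: "K \<in> \<C>" "a \<in> K" "- a + b \<in> K" by blast
      then have "deductive K" using \<open>subset.chain ?\<F> \<C>\<close> unfolding subset_chain_def by blast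
      then show ?thesis using K deductive_mp by blast
    qed
    obtain F where "F \<in> \<C>" using \<open>\<C> \<noteq> {}\<close> by blast
    then have "1 \<in> \<Union>\<C>"
      using deductive_one \<open>subset.chain ?\<F> \<C>\<close> unfolding subset_chain_def by blast
    with mp have "deductive (\<Union>\<C>)" unfolding deductive_def by (intro conjI allI impI)
    then show ?thesis using \<open>subset.chain ?\<F> \<C>\<close> unfolding subset_chain_def by blast
  qed
  ultimately have "\<exists>F\<in>?\<F>. \<forall>X\<in>?\<F>. F \<subseteq> X \<longrightarrow> X = F"
    by (intro subset_Zorn_nonempty) auto
  then obtain F where F: "deductive F" "d \<notin> F"
    and max: "\<And>X. deductive X \<Longrightarrow> d \<notin> X \<Longrightarrow> F \<subseteq> X \<Longrightarrow> X = F" by blast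
  have ex_power: "\<exists>n. - (u ^ n) + d \<in> F" if "u \<notin> F" for u
  proof (rule ccontr)
    let ?X = "{c. \<exists>n. - (u ^ n) + c \<in> F}"
    assume "\<not> ?thesis"
    then have "d \<notin> ?X" by simp
    moreover have "- (u ^ 0) + a \<in> F" if "a \<in> F" for a
      using that by simp
    then have "F \<subseteq> ?X" by (simp only: subset_iff mem_Collect_eq) metis
    ultimately have X: "?X = F" using max deductive_adjoin[OF F(1)] by metis
    have "- (u ^ 1) + u \<in> F" using deductive_one[OF F(1)] by (simp add: add.commute)
    then have "u \<in> ?X" by (simp only: mem_Collect_eq) metis
    then show False using that X by simp
  qed
  have "- a + b \<in> F \<or> - b + a \<in> F" for a b
  proof (rule ccontr)
    assume "\<not> ?thesis"
    then obtain m n where mn: "- ((- a + b) ^ m) + d \<in> F" "- ((- b + a) ^ n) + d \<in> F"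
      using ex_power by blast
    define p q where "p = (- a + b) ^ m" and "q = (- b + a) ^ n"
    \<comment> \<open>With \<open>- p + d\<close> read as an implication, \<open>?z\<close> is
      reasoning by cases: if \<open>p\<close> gives \<open>d\<close> and \<open>q\<close> gives
      \<open>d\<close>, then \<open>d\<close>. It lies above \<open>p\<close> and \<open>q\<close>,
      hence equals \<open>1\<close>, and modus ponens applied twice yields \<open>d\<close>.\<close>
    let ?z = "- (- p + d) + (- (- q + d) + d)"
    have "p \<le> - (- p + d) + d" "q \<le> - (- q + d) + d"
      using mult_imp_le[of p d] mult_imp_le[of q d] by (simp_all only: mult_le_iff)
    moreover have "- (- p + d) + d \<le> ?z" by (intro add_mono' order.refl le_add(2))
    moreover have "- (- q + d) + d \<le> ?z" by (rule le_add(2))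
    ultimately have "p \<le> ?z" "q \<le> ?z" by (blast intro: order.trans)+
    then have "?z = 1"
      unfolding p_def q_def by (rule prelinear_power)
    then have "?z \<in> F" using deductive_one F(1) by simp
    then have "- (- q + d) + d \<in> F"
      using deductive_mp[OF F(1)] mn(1) unfolding p_def by blast
    then have "d \<in> F"
      using deductive_mp[OF F(1)] mn(2) unfolding q_def by blast
    with F(2) show False ..
  qed
  then show ?thesis using F unfolding prime_def by blast
qed

section \<open>The congruence of a filter\<close>

definition filter_eq :: "'a set \<Rightarrow> 'a \<Rightarrow> 'a \<Rightarrow> bool" where
  "filter_eq F a b \<longleftrightarrow> - a + b \<in> F \<and> - b + a \<in> F"

lemma imp_trans: "(- a + b) * (- b + c) \<le> - a + c"
proof -
  have "a * ((- a + b) * (- b + c)) = (a * (- a + b)) * (- b + c)"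
    by (simp only: ac_simps)
  also have "\<dots> \<le> b * (- b + c)" by (intro mult_mono' mult_imp_le order.refl)
  also have "\<dots> \<le> c" by (rule mult_imp_le)
  finally have "((- a + b) * (- b + c)) * a \<le> c" by (simp only: mult.commute)
  then show ?thesis by (simp only: mult_le_iff)
qed

text \<open>\<open>- a\<close> lies below the join of \<open>- a\<close> and \<open>c\<close>, which
  is \<open>- (a + c) + c\<close>; then \<open>b\<close> is added.\<close>

lemma imp_add_mono: "- a + b \<le> - (a + c) + (b + c)"
proof -
  have "- a \<le> - a * - c + c"
    unfolding lukasiewicz[of "- a" c] by (rule le_add)
  then have "- a + b \<le> - a * - c + c + b" by (rule add_right_mono')
  also have "\<dots> = - (a + c) + (b + c)" by (simp only: neg_add ac_simps)
  finally show ?thesis .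
qed

lemma filter_eq_refl: "deductive F \<Longrightarrow> filter_eq F a a"
  using deductive_one by (simp add: filter_eq_def add.commute)

lemma equivp_filter_eq:
  assumes "deductive F"
  shows "equivp (filter_eq F)"
proof (rule equivpI)
  show "transp (filter_eq F)"
    using deductive_mult[OF assms _ _ imp_trans] unfolding transp_def filter_eq_def by blast
  show "reflp (filter_eq F)" using assms by (simp add: reflp_def filter_eq_refl)
  show "symp (filter_eq F)" unfolding symp_def filter_eq_def by blast
qed

lemma filter_eq_add:
  assumes "deductive F" "filter_eq F a b" "filter_eq F c d"
  shows "filter_eq F (a + c) (b + d)"
proof -
  have *: "filter_eq F (a + c) (b + c)" if "filter_eq F a b" for a b c
    using that deductive_upward[OF assms(1) _ imp_add_mono] unfolding filter_eq_def by blast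
  then have "filter_eq F (c + b) (d + b)" using assms by blast
  then have "filter_eq F (b + c) (b + d)" by (simp only: add.commute)
  then show ?thesis
    using *[OF assms(2), of c] equivp_transp[OF equivp_filter_eq[OF assms(1)]] by blast
qed

lemma filter_eq_neg: "filter_eq F a b \<Longrightarrow> filter_eq F (- a) (- b)"
  unfolding filter_eq_def neg_neg by (simp only: add.commute)

lemma filter_eq_mult:
  assumes "deductive F" "filter_eq F a b" "filter_eq F c d"
  shows "filter_eq F (a * c) (b * d)"
proof -
  have "filter_eq F (- (- a + - c)) (- (- b + - d))"
    by (intro filter_eq_neg filter_eq_add assms)
  then show ?thesis by (simp only: neg_add neg_neg)
qed

lemma filter_eq_one_iff: "deductive F \<Longrightarrow> filter_eq F a 1 \<longleftrightarrow> a \<in> F"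
  using deductive_one by (simp add: filter_eq_def)

end

section \<open>MV-chains and addition with carry\<close>

class mv_chain = mv_algebra + linorder
begin

text \<open>In a chain \<open>x\<close> and \<open>- y\<close> are comparable. So the untruncated
  sum is either \<open>x + y\<close>, without carry, or one unit plus \<open>x * y\<close>.\<close>

lemma add_eq_one_or_mult_eq_zero: "x + y \<noteq> 1 \<Longrightarrow> x * y = 0"
  using linear[of x "- y"] neg_le_iff[of y x] le_neg_iff[of x y] by (simp add: add.commute)

text \<open>While \<open>y + z\<close> stays below the cap, multiplication by \<open>- z\<close>
  recovers both summands from their sums, so these remain distinct.\<close>

lemma add_strict_mono':
  assumes "x < y" "y + z \<noteq> 1"
  shows "x + z < y + z"
proof -
  have "y \<le> - z" using assms(2) by (simp add: le_neg_iff add_eq_one_or_mult_eq_zero)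
  have y: "(y + - (- z)) * - z = y"
    by (rule add_mult_neg_absorb) fact
  have x: "(x + - (- z)) * - z = x"
    by (rule add_mult_neg_absorb) (rule order.trans[OF less_imp_le[OF assms(1)] \<open>y \<le> - z\<close>])
  have "x + z \<noteq> y + z"
    using x y assms(1) unfolding neg_neg by (metis less_irrefl)
  moreover have "x + z \<le> y + z" using assms(1) by (intro add_right_mono' less_imp_le)
  ultimately show ?thesis unfolding less_le by blast
qed

lemma mult_strict_mono':
  assumes "x < y" "x + z = 1"
  shows "x * z < y * z"
proof -
  have "- z \<le> x" using assms(2) unfolding neg_le_iff by (simp only: add.commute)
  have x: "x * - (- z) + - z = x"
    by (rule mult_neg_add_absorb) fact
  have y: "y * - (- z) + - z = y"
    by (rule mult_neg_add_absorb) (rule order.trans[OF \<open>- z \<le> x\<close> less_imp_le[OF assms(1)]])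
  have "x * z \<noteq> y * z"
    using x y assms(1) unfolding neg_neg by (metis less_irrefl)
  moreover have "x * z \<le> y * z" using assms(1) by (intro mult_mono' less_imp_le order.refl)
  ultimately show ?thesis unfolding less_le by blast
qed

lemma middle_sum_disjoint:
  assumes "b * x = 0" "b * y = 0"
  shows "y * (b + x) = x * (b + y)"
proof -
  have "x \<le> - b" "y \<le> - b" using assms by (simp_all add: le_neg_iff mult.commute)
  then have "(x + b) * - b = x" "(y + b) * - b = y"
    using add_mult_neg_absorb[of x "- b"] add_mult_neg_absorb[of y "- b"] by simp_all
  then have "y * (b + x) = ((y + b) * - b) * (b + x)" "x * (b + y) = ((x + b) * - b) * (b + y)"
    by simp_all
  then show ?thesis by (simp only: ac_simps)
qed

lemma middle_sum_covering:
  assumes "b + x = 1" "b + y = 1"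
  shows "b * x + y = b * y + x"
proof -
  have "- b \<le> x" "- b \<le> y" using assms by (simp_all add: neg_le_iff)
  then have "x * b + - b = x" "y * b + - b = y"
    using mult_neg_add_absorb[of "- b" x] mult_neg_add_absorb[of "- b" y] by simp_all
  then have "b * x + y = b * x + (y * b + - b)" "b * y + x = b * y + (x * b + - b)"
    by simp_all
  then show ?thesis by (simp only: ac_simps)
qed

text \<open>Splitting \<open>b\<close> into \<open>b * x\<close> and \<open>- x\<close> turns
  \<open>b + y\<close> into \<open>(b * x + y) + - x\<close>. Multiplication by \<open>x\<close>
  undoes the addition of \<open>- x\<close> because \<open>b * x + y \<le> x\<close>.\<close>

lemma middle_sum_mixed:
  assumes "b + x = 1" "b * y = 0"
  shows "b * x + y = x * (b + y)"
proof -
  have bx: "- b \<le> x" and xb: "- x \<le> b" and yb: "y \<le> - b"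
    using assms by (simp_all add: neg_le_iff le_neg_iff add.commute mult.commute)
  have "b * x + - x = b"
    using mult_neg_add_absorb[OF xb] by simp
  then have "b + y = (b * x + - x) + y" by simp
  then have "(b * x + y) + - x = b + y" by (simp only: ac_simps)
  moreover have "b * x + y \<le> b * x + - b"
    by (intro add_mono' order.refl yb)
  then have "b * x + y \<le> x"
    using mult_neg_add_absorb[OF bx] by (simp add: mult.commute)
  then have "(b * x + y + - x) * x = b * x + y"
    by (rule add_mult_neg_absorb)
  ultimately show ?thesis by (simp add: mult.commute)
qed

text \<open>If adding \<open>x\<close> and then \<open>y\<close> to the fraction \<open>b\<close>
  causes exactly one carry, the new fraction is \<open>b * x + y\<close> or
  \<open>y * (b + x)\<close>, depending on when the carry occurs; the left-hand side covers both.
  The equation says that the order of the two additions is irrelevant.\<close>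

lemma middle_sum: "b * x + y * (b + x) = b * y + x * (b + y)"
proof (cases "b + x = 1"; cases "b + y = 1")
  assume "b + x = 1" "b + y = 1"
  then show ?thesis using middle_sum_covering by simp
next
  assume *: "b + x = 1" "b + y \<noteq> 1"
  then show ?thesis using middle_sum_mixed[of b x y] add_eq_one_or_mult_eq_zero[of b y] by simp
next
  assume *: "b + x \<noteq> 1" "b + y = 1"
  then show ?thesis using middle_sum_mixed[of b y x] add_eq_one_or_mult_eq_zero[of b x] by simp
next
  assume "b + x \<noteq> 1" "b + y \<noteq> 1"
  then show ?thesis using middle_sum_disjoint[of b x y] add_eq_one_or_mult_eq_zero by simp
qed

end

text \<open>The pair \<open>(m, a)\<close> with \<open>a < 1\<close> stands for the element \<open>m + a\<close> of Chang's totally ordered group.\<close>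

fun carry_add :: "'a::mv_chain \<Rightarrow> nat \<times> 'a \<Rightarrow> nat \<times> 'a" where
  "carry_add x (m, a) = (if a + x = 1 then (Suc m, a * x) else (m, a + x))"

text \<open>The branches stand for no, one and two carries. The first and the last are visibly
  symmetric in \<open>x\<close> and \<open>y\<close>, the middle one is so by
  \<open>middle_sum\<close>.\<close>

lemma carry_add_twice:
  "carry_add y (carry_add x (m, b)) =
    (if b + x + y \<noteq> 1 then (m, b + x + y)
     else if b * x + y * (b + x) \<noteq> 1 then (Suc m, b * x + y * (b + x))
     else (Suc (Suc m), b * x * y))"
proof (cases "b + x = 1")
  case False
  moreover have "(b + x) * y \<noteq> 1"
    using False mult_eq_one[of "b + x" y] by blast
  ultimately show ?thesis using add_eq_one_or_mult_eq_zero[of b x] by (simp add: mult.commute)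
qed simp

lemma carry_add_commute: "carry_add y (carry_add x p) = carry_add x (carry_add y p)"
proof (cases p)
  case (Pair m b)
  show ?thesis
    unfolding Pair carry_add_twice middle_sum[of b x y] by (simp only: ac_simps)
qed

lemma carry_add_fraction: "snd p \<noteq> 1 \<Longrightarrow> snd (carry_add x p) \<noteq> 1"
  by (cases p) (auto dest: mult_eq_one)

text \<open>The fraction \<open>1\<close> must be excluded: \<open>(m, 1)\<close> and
  \<open>(Suc m, 0)\<close> stand for the same number and become equal when any \<open>x\<close>
  other than \<open>1\<close> is added, but they differ in the lexicographic order.\<close>

lemma carry_add_strict_mono:
  assumes "p < q" "snd p \<noteq> 1"
  shows "carry_add x p < carry_add x q"
proof -
  obtain m a n b where p: "p = (m, a)" and q: "q = (n, b)" by fastforce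
  consider "m = n" "a < b" | "m < n" using assms by (auto simp: p q le_less)
  then show ?thesis
  proof cases
    case 1
    show ?thesis
    proof (cases "a + x = 1")
      case True
      then have "b + x = 1" using add_right_mono'[of a b x] 1 by simp
      then show ?thesis using True 1 mult_strict_mono'[of a b x] by (simp add: p q)
    next
      case False
      then show ?thesis using 1 add_strict_mono'[of a b x] by (auto simp: p q)
    qed
  next
    case 2
    \<comment> \<open>The critical case is \<open>Suc m = n\<close> with a carry on the left only,
      where the fractions decide.\<close>
    have "a * x < b + x" if "a + x = 1" "b + x \<noteq> 1"
    proof -
      have "a < 1" using assms by (simp add: p less_le)
      then have "a * x < 1 * x" using that by (intro mult_strict_mono')
      then have "a * x < x" by simp
      also have "x \<le> b + x" by simp
      finally show ?thesis .
    qed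
    then show ?thesis using 2 by (auto simp: p q)
  qed
qed

definition carry_sum :: "('g \<Rightarrow> 'a::mv_chain) \<Rightarrow> 'g multiset \<Rightarrow> nat \<times> 'a" where
  "carry_sum h M = fold_mset (\<lambda>g. carry_add (h g)) (0, 0) M"

lemma carry_sum_empty [simp]: "carry_sum h {#} = (0, 0)"
  by (simp add: carry_sum_def)

lemma carry_sum_add_mset [simp]: "carry_sum h (add_mset g M) = carry_add (h g) (carry_sum h M)"
proof -
  interpret comp_fun_commute "\<lambda>g. carry_add (h g)"
    by standard (simp add: fun_eq_iff carry_add_commute)
  show ?thesis by (simp add: carry_sum_def)
qed

lemma carry_sum_fraction:
  fixes h :: "'g \<Rightarrow> 'a::mv_chain"
  assumes "(0 :: 'a) \<noteq> 1"
  shows "snd (carry_sum h M) \<noteq> 1"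
  by (induction M) (simp_all add: assms carry_add_fraction)

lemma carry_sum_le_iff:
  fixes h :: "'g \<Rightarrow> 'a::mv_chain"
  assumes "(0 :: 'a) \<noteq> 1"
  shows "carry_sum h (add_mset g N) \<le> carry_sum h (add_mset g M) \<longleftrightarrow> carry_sum h N \<le> carry_sum h M"
proof -
  have strict: "carry_sum h (add_mset g N) < carry_sum h (add_mset g M)"
    if "carry_sum h N < carry_sum h M" for M N
    using carry_add_strict_mono[OF that carry_sum_fraction[OF assms]] by simp
  show ?thesis
  proof (cases "carry_sum h N" "carry_sum h M" rule: linorder_cases)
    case less
    then show ?thesis using strict[OF less] by (simp only: less_imp_le)
  next
    case greater
    then show ?thesis using strict[OF greater] by (simp only: not_le[symmetric])
  qed simp
qed

section \<open>Formulae in MV-algebras and the transfer to the reals\<close>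

primrec interp :: "(nat \<Rightarrow> 'a::mv_algebra) \<Rightarrow> form \<Rightarrow> 'a" where
  "interp v (Var i) = v i"
| "interp v \<zero> = 0"
| "interp v \<one> = 1"
| "interp v (a \<oplus> b) = interp v a + interp v b"
| "interp v (a \<odot> b) = interp v a * interp v b"
| "interp v (\<sim> a) = - interp v a"

primrec subforms :: "form \<Rightarrow> form set" where
  "subforms (Var i) = {Var i}"
| "subforms \<zero> = {\<zero>}"
| "subforms \<one> = {\<one>}"
| "subforms (a \<oplus> b) = insert (a \<oplus> b) (subforms a \<union> subforms b)"
| "subforms (a \<odot> b) = insert (a \<odot> b) (subforms a \<union> subforms b)"
| "subforms (\<sim> a) = insert (\<sim> a) (subforms a)"

lemma subforms_self: "t \<in> subforms t"
  by (cases t) auto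

lemma finite_subforms: "finite (subforms t)"
  by (induction t) auto

lemma subforms_closed:
  "a \<oplus> b \<in> subforms t \<Longrightarrow> a \<in> subforms t \<and> b \<in> subforms t"
  "a \<odot> b \<in> subforms t \<Longrightarrow> a \<in> subforms t \<and> b \<in> subforms t"
  "\<sim> a \<in> subforms t \<Longrightarrow> a \<in> subforms t"
  by (induction t) (auto simp: subforms_self)

text \<open>Every subformula becomes a variable of a linear system, which the carry sums solve in Chang's
  group; a real solution of that system is a valuation in \<open>[0, 1]\<close>.\<close>

theorem chain_counterexample_real:
  fixes v :: "nat \<Rightarrow> 'a::mv_chain"
  assumes "interp v t \<noteq> 1"
  shows "\<exists>x. (\<forall>i. x i \<in> {0..1}) \<and> eval x t \<noteq> 1"
proof -
  let ?h = "interp v"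
  define I where "I = insert \<one> (insert \<zero> (subforms t))"
  \<comment> \<open>Two summands per side suffice: each connective is determined by comparisons such
    as that of \<open>\<one>\<close> plus \<open>a \<odot> b\<close> with \<open>a\<close> plus
    \<open>b\<close>. For these \<open>I\<close> contains the constants even if \<open>t\<close>
    does not.\<close>
  define \<M> where "\<M> = {M. set_mset M \<subseteq> I \<and> size M \<le> 2}"
  have nontriv: "(0 :: 'a) \<noteq> 1"
    using assms by (metis antisym le_one zero_le)
  have "finite I" by (simp add: I_def finite_subforms)
  have "\<M> \<subseteq> mset ` {xs. set xs \<subseteq> I \<and> length xs \<le> 2}"
  proof
    fix M assume "M \<in> \<M>"
    moreover obtain xs where "M = mset xs" by (metis ex_mset)
    ultimately show "M \<in> mset ` {xs. set xs \<subseteq> I \<and> length xs \<le> 2}" by (auto simp: \<M>_def)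
  qed
  then have fin: "finite \<M>"
    using finite_lists_length_le[OF \<open>finite I\<close>] by (meson finite_imageI finite_subset)
  have sub: "set_mset M \<subseteq> I" if "M \<in> \<M>" for M
    using that by (simp add: \<M>_def)
  obtain x :: "form \<Rightarrow> real" where "\<forall>M\<in>\<M>. \<forall>N\<in>\<M>.
      carry_sum ?h N \<le> carry_sum ?h M \<longleftrightarrow> (\<Sum>g\<in>#N. x g) \<le> (\<Sum>g\<in>#M. x g)"
    using multiset_order_representation[OF carry_sum_le_iff[OF nontriv] \<open>finite I\<close> fin sub] by (rule exE)
  then have x: "carry_sum ?h N \<le> carry_sum ?h M \<longleftrightarrow> (\<Sum>g\<in>#N. x g) \<le> (\<Sum>g\<in>#M. x g)"
    if "M \<in> \<M>" "N \<in> \<M>" for M N using that by simp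
  have \<M>: "{#} \<in> \<M>" "a \<in> I \<Longrightarrow> {#a#} \<in> \<M>" "a \<in> I \<Longrightarrow> b \<in> I \<Longrightarrow> {#a, b#} \<in> \<M>" for a b
    by (auto simp: \<M>_def)
  have one: "\<one> \<in> I" and zero: "\<zero> \<in> I" by (simp_all add: I_def)
  have le: "(\<Sum>g\<in>#N. x g) \<le> (\<Sum>g\<in>#M. x g)"
    if "carry_sum ?h N \<le> carry_sum ?h M" "M \<in> \<M>" "N \<in> \<M>" for M N
    using x[OF that(2,3)] that(1) by simp
  have less: "(\<Sum>g\<in>#N. x g) < (\<Sum>g\<in>#M. x g)"
    if "carry_sum ?h N < carry_sum ?h M" "M \<in> \<M>" "N \<in> \<M>" for M N
    using x[OF that(3,2)] that(1) by (meson not_le)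
  have eq: "(\<Sum>g\<in>#N. x g) = (\<Sum>g\<in>#M. x g)"
    if "carry_sum ?h N = carry_sum ?h M" "M \<in> \<M>" "N \<in> \<M>" for M N
    using le[of M N] le[of N M] that by (intro antisym) simp_all
  have single: "carry_sum ?h {#a#} = (if ?h a \<noteq> 1 then (0, ?h a) else (1, 0))" for a
    by simp
  have pair: "carry_sum ?h {#a, b#} = (if ?h a + ?h b \<noteq> 1 then (0, ?h a + ?h b)
      else if ?h a * ?h b \<noteq> 1 then (1, ?h a * ?h b) else (2, 0))" for a b
    by (simp del: carry_add.simps add: carry_add_twice add.commute numeral_2_eq_2)
  have x_zero: "x \<zero> = 0"
    using eq[of "{#\<zero>#}" "{#}"] \<M> zero nontriv by (simp add: single del: carry_sum_add_mset)
  have x_one: "0 < x \<one>"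
    using less[of "{#}" "{#\<one>#}"] \<M> one by (simp add: single del: carry_sum_add_mset)
  have x_nonneg: "0 \<le> x a" if "a \<in> I" for a
    using le[of "{#}" "{#a#}"] \<M> that by (simp add: single del: carry_sum_add_mset)
  have x_le: "x a \<le> x \<one>" if "a \<in> I" for a
    using le[of "{#a#}" "{#\<one>#}"] \<M> that one by (simp add: single del: carry_sum_add_mset)
  have x_less: "x a < x \<one>" if "a \<in> I" "?h a \<noteq> 1" for a
    using less[of "{#a#}" "{#\<one>#}"] \<M> that one by (simp add: single del: carry_sum_add_mset)
  have x_oplus: "x (a \<oplus> b) = min (x \<one>) (x a + x b)" if "a \<oplus> b \<in> I" "a \<in> I" "b \<in> I" for a b
  proof (cases "?h a + ?h b = 1")
    case True
    then have "x (a \<oplus> b) = x \<one>"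
      using eq[of "{#a \<oplus> b#}" "{#\<one>#}"] \<M> that one by (simp add: single del: carry_sum_add_mset)
    moreover have "x \<one> \<le> x a + x b"
      using True le[of "{#\<one>#}" "{#a, b#}"] \<M> that one
      by (simp add: single pair del: carry_sum_add_mset)
    ultimately show ?thesis by simp
  next
    case False
    then have "x (a \<oplus> b) = x a + x b"
      using eq[of "{#a \<oplus> b#}" "{#a, b#}"] \<M> that by (simp add: single pair del: carry_sum_add_mset)
    then show ?thesis using x_le[OF that(1)] by simp
  qed
  have x_odot: "x (a \<odot> b) = max 0 (x a + x b - x \<one>)" if "a \<odot> b \<in> I" "a \<in> I" "b \<in> I" for a b
  proof (cases "?h a + ?h b = 1")
    case True
    then have "x \<one> + x (a \<odot> b) = x a + x b"
      using eq[of "{#\<one>, a \<odot> b#}" "{#a, b#}"] \<M> that one by (simp add: pair del: carry_sum_add_mset)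
    then show ?thesis using x_nonneg[OF that(1)] by simp
  next
    case False
    then have "?h a * ?h b = 0" by (rule add_eq_one_or_mult_eq_zero)
    then have "x (a \<odot> b) = 0"
      using eq[of "{#a \<odot> b#}" "{#}"] \<M> that nontriv by (simp add: single del: carry_sum_add_mset)
    moreover have "x a + x b \<le> x \<one>"
      using False le[of "{#a, b#}" "{#\<one>#}"] \<M> that one
      by (simp add: single pair del: carry_sum_add_mset)
    ultimately show ?thesis by simp
  qed
  have x_neg: "x (\<sim> a) = x \<one> - x a" if "\<sim> a \<in> I" "a \<in> I" for a
    using eq[of "{#a, \<sim> a#}" "{#\<one>#}"] \<M> that one nontriv
    by (simp add: single pair del: carry_sum_add_mset)
  \<comment> \<open>Dividing by \<open>x \<one>\<close> turns the unit into the number 1. Variables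
    outside \<open>t\<close> get the value 0 so as to stay in the interval.\<close>
  define y where "y i = (if Var i \<in> I then x (Var i) / x \<one> else 0)" for i
  have eval_y: "a \<in> subforms t \<Longrightarrow> eval y a = x a / x \<one>" for a
  proof (induction a)
    case (Oplus a b)
    then have "a \<in> subforms t" "b \<in> subforms t" using subforms_closed by blast+
    then show ?case using Oplus x_oplus[of a b] x_one
      by (simp add: I_def min_divide_distrib_right add_divide_distrib)
  next
    case (Odot a b)
    then have "a \<in> subforms t" "b \<in> subforms t" using subforms_closed by blast+
    then show ?case using Odot x_odot[of a b] x_one
      by (simp add: I_def max_divide_distrib_right add_divide_distrib diff_divide_distrib)
  next
    case (Neg a)
    then have "a \<in> subforms t" using subforms_closed by blast
    then show ?case using Neg x_neg[of a] x_one
      by (simp add: I_def field_simps)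
  qed (use x_zero x_one in \<open>simp_all add: y_def I_def\<close>)
  have "t \<in> I" by (simp add: I_def subforms_self)
  then have "eval y t \<noteq> 1"
    using eval_y[OF subforms_self] x_less[of t] assms x_one by simp
  moreover have "y i \<in> {0..1}" for i
    using x_nonneg x_le x_one by (simp add: y_def)
  ultimately show ?thesis by blast
qed

section \<open>Completeness of the MV axioms\<close>

definition mv_step :: "form \<Rightarrow> form \<Rightarrow> bool" where
  "mv_step t t' \<longleftrightarrow> (\<exists>e\<in>MV. deriv_step e t t')"

abbreviation mv_eq :: "form \<Rightarrow> form \<Rightarrow> bool" where
  "mv_eq \<equiv> mv_step\<^sup>*\<^sup>*"

lemma subst_subst: "subst \<sigma> (subst \<zeta> t) = subst (\<lambda>i. subst \<sigma> (\<zeta> i)) t"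
  by (induction t) auto

lemma subst_cong: "(\<And>i. i \<in> fvars t \<Longrightarrow> \<sigma> i = \<zeta> i) \<Longrightarrow> subst \<sigma> t = subst \<zeta> t"
  by (induction t) auto

lemma subst_Var: "subst Var t = t"
  by (induction t) auto

lemma eval_subst: "eval x (subst \<zeta> t) = eval (\<lambda>i. eval x (\<zeta> i)) t"
  by (induction t) auto

lemma eval_cong: "(\<And>i. i \<in> fvars t \<Longrightarrow> x i = y i) \<Longrightarrow> eval x t = eval y t"
  by (induction t) auto

lemma eval_in_unit: "(\<And>i. x i \<in> {0..1}) \<Longrightarrow> eval x t \<in> {0..1}"
  by (induction t) auto

lemma replace_one_sym: "replace_one g g' t t' \<Longrightarrow> replace_one g' g t' t"
  by (induction rule: replace_one.induct) (auto intro: replace_one.intros)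

lemma replace_one_subst: "replace_one g g' t t' \<Longrightarrow> replace_one (subst \<sigma> g) (subst \<sigma> g') (subst \<sigma> t) (subst \<sigma> t')"
  by (induction rule: replace_one.induct) (auto intro: replace_one.intros)

lemma replace_one_eval: "replace_one g g' t t' \<Longrightarrow> eval x g = eval x g' \<Longrightarrow> eval x t = eval x t'"
  by (induction rule: replace_one.induct) auto

lemma mv_step_sym: "mv_step t t' \<Longrightarrow> mv_step t' t"
  unfolding mv_step_def deriv_step_def using replace_one_sym by blast

lemma mv_step_subst:
  assumes "mv_step t t'"
  shows "mv_step (subst \<sigma> t) (subst \<sigma> t')"
proof -
  obtain e g g' \<zeta> where "e \<in> MV" "replace_one g g' t t'"
    and "(g, g') = (subst \<zeta> (fst e), subst \<zeta> (snd e)) \<or> (g, g') = (subst \<zeta> (snd e), subst \<zeta> (fst e))"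
    using assms unfolding mv_step_def deriv_step_def by blast
  then show ?thesis
    using replace_one_subst[of g g' t t' \<sigma>] unfolding mv_step_def deriv_step_def
    by (intro bexI[of _ e] exI[of _ "subst \<sigma> g"] exI[of _ "subst \<sigma> g'"] exI[of _ "\<lambda>i. subst \<sigma> (\<zeta> i)"])
      (auto simp: subst_subst)
qed

lemma mv_axiom: "(a, b) \<in> MV \<Longrightarrow> mv_eq (subst \<zeta> a) (subst \<zeta> b)"
  unfolding mv_step_def deriv_step_def
  by (intro r_into_rtranclp bexI[of _ "(a, b)"] exI) (auto intro: replace_one.here)

lemma MV_sound: "(a, b) \<in> MV \<Longrightarrow> (\<And>i. x i \<in> {0..1}) \<Longrightarrow> eval x a = eval x b"
proof -
  assume "(a, b) \<in> MV" and x: "\<And>i. x i \<in> {0..1}"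
  have "x 0 \<ge> 0" "x 0 \<le> 1" "x 1 \<ge> 0" "x 1 \<le> 1" "x 2 \<ge> 0" "x 2 \<le> 1"
    using x by auto
  with \<open>(a, b) \<in> MV\<close> show ?thesis
    unfolding MV_def Let_def by (elim insertE emptyE) (auto simp: min_def max_def)
qed

lemma deriv_step_sound:
  assumes "e \<in> MV" "deriv_step e t t'" "\<And>i. x i \<in> {0..1}"
  shows "eval x t = eval x t'"
proof -
  have "eval x (subst \<zeta> (fst e)) = eval x (subst \<zeta> (snd e))" for \<zeta>
    unfolding eval_subst using assms by (intro MV_sound eval_in_unit) auto
  then show ?thesis
    using assms(2) replace_one_eval unfolding deriv_step_def by (metis prod.inject)
qed

lemma mv_eq_context:
  assumes "\<And>g g' t t'. replace_one g g' t t' \<Longrightarrow> replace_one g g' (C t) (C t')" "mv_eq a b"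
  shows "mv_eq (C a) (C b)"
  using assms(2)
proof (induction rule: rtranclp_induct)
  case (step b c)
  have "mv_step (C b) (C c)"
    using step.hyps(2) assms(1) unfolding mv_step_def deriv_step_def by blast
  with step.IH show ?case by (rule rtranclp.rtrancl_into_rtrancl)
qed simp

lemma mv_eq_Neg: "mv_eq a b \<Longrightarrow> mv_eq (\<sim> a) (\<sim> b)"
  by (rule mv_eq_context) (rule replace_one.neg)

lemma mv_eq_Oplus: "mv_eq a b \<Longrightarrow> mv_eq c d \<Longrightarrow> mv_eq (a \<oplus> c) (b \<oplus> d)"
  by (rule rtranclp_trans[OF mv_eq_context[of "\<lambda>t. t \<oplus> c"] mv_eq_context[of "\<lambda>t. b \<oplus> t"]])
    (auto intro: replace_one.intros)

lemma mv_eq_Odot: "mv_eq a b \<Longrightarrow> mv_eq c d \<Longrightarrow> mv_eq (a \<odot> c) (b \<odot> d)"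
  by (rule rtranclp_trans[OF mv_eq_context[of "\<lambda>t. t \<odot> c"] mv_eq_context[of "\<lambda>t. b \<odot> t"]])
    (auto intro: replace_one.intros)

\<comment> \<open>The Lindenbaum algebra\<close>
quotient_type lindenbaum = form / mv_eq
proof (rule equivpI)
  show "symp mv_eq"
    using symp_rtranclp[of mv_step] mv_step_sym by (simp add: symp_def)
qed (auto simp: reflp_def transp_def)

instantiation lindenbaum :: mv_algebra
begin

lift_definition zero_lindenbaum :: lindenbaum is \<zero> .
lift_definition one_lindenbaum :: lindenbaum is \<one> .
lift_definition plus_lindenbaum :: "lindenbaum \<Rightarrow> lindenbaum \<Rightarrow> lindenbaum" is Oplus
  by (rule mv_eq_Oplus)
lift_definition times_lindenbaum :: "lindenbaum \<Rightarrow> lindenbaum \<Rightarrow> lindenbaum" is Odot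
  by (rule mv_eq_Odot)
lift_definition uminus_lindenbaum :: "lindenbaum \<Rightarrow> lindenbaum" is Neg
  by (rule mv_eq_Neg)
definition "x \<le> y \<longleftrightarrow> - x + y = (1 :: lindenbaum)"
definition "x < y \<longleftrightarrow> x \<le> y \<and> \<not> y \<le> (x :: lindenbaum)"

instance
proof
  fix a b c :: lindenbaum
  define \<zeta> :: "form \<Rightarrow> form \<Rightarrow> form \<Rightarrow> nat \<Rightarrow> form"
    where "\<zeta> x y z = (\<lambda>i. if i = 0 then x else if i = 1 then y else z)" for x y z
  have ax: "mv_eq (subst (\<zeta> x y z) l) (subst (\<zeta> x y z) r)" if "(l, r) \<in> MV" for l r x y z
    using that by (rule mv_axiom)
  have \<zeta>: "\<zeta> x y z 0 = x" "\<zeta> x y z 1 = y" "\<zeta> x y z (Suc 0) = y" "\<zeta> x y z 2 = z" for x y z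
    by (simp_all add: \<zeta>_def)
  note ax = ax[unfolded MV_def Let_def, simplified insert_iff empty_iff simp_thms prod.inject]
  show comm: "a + b = b + a" for a b :: lindenbaum
    by transfer (use ax[of "Var 0 \<oplus> Var 1" "Var 1 \<oplus> Var 0"] in \<open>simp add: \<zeta>\<close>)
  show mcomm: "a * b = b * a" for a b :: lindenbaum
    by transfer (use ax[of "Var 0 \<odot> Var 1" "Var 1 \<odot> Var 0"] in \<open>simp add: \<zeta>\<close>)
  have "a + (b + c) = (a + b) + c"
    by transfer (use ax[of "Var 0 \<oplus> (Var 1 \<oplus> Var 2)" "(Var 0 \<oplus> Var 1) \<oplus> Var 2"] in \<open>simp add: \<zeta>\<close>)
  then show "a + b + c = a + (b + c)" by simp
  have "a * (b * c) = (a * b) * c"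
    by transfer (use ax[of "Var 0 \<odot> (Var 1 \<odot> Var 2)" "(Var 0 \<odot> Var 1) \<odot> Var 2"] in \<open>simp add: \<zeta>\<close>)
  then show "a * b * c = a * (b * c)" by simp
  have "a + 0 = a"
    by transfer (use ax[of "Var 0 \<oplus> \<zero>" "Var 0"] in \<open>simp add: \<zeta>\<close>)
  then show "0 + a = a" by (simp add: comm)
  have "a * 1 = a"
    by transfer (use ax[of "Var 0 \<odot> \<one>" "Var 0"] in \<open>simp add: \<zeta>\<close>)
  then show "1 * a = a" by (simp add: mcomm)
  show "a + 1 = 1"
    by transfer (use ax[of "Var 0 \<oplus> \<one>" "\<one>"] in \<open>simp add: \<zeta>\<close>)
  show "a + - a = 1"
    by transfer (use ax[of "Var 0 \<oplus> \<sim> Var 0" "\<one>"] in \<open>simp add: \<zeta>\<close>)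
  have "a = - (- a)"
    by transfer (use ax[of "Var 0" "\<sim> (\<sim> Var 0)"] in \<open>simp add: \<zeta>\<close>)
  then show "- (- a) = a" by simp
  show "- (a + b) = - a * - b"
    by transfer (use ax[of "\<sim> (Var 0 \<oplus> Var 1)" "\<sim> Var 0 \<odot> \<sim> Var 1"] in \<open>simp add: \<zeta>\<close>)
  show "- 0 = (1 :: lindenbaum)"
    by transfer (use ax[of "\<sim> \<zero>" "\<one>"] in \<open>simp add: \<zeta>\<close>)
  show "a * - b + b = b * - a + a"
    by transfer (use ax[of "(Var 0 \<odot> \<sim> Var 1) \<oplus> Var 1" "(Var 1 \<odot> \<sim> Var 0) \<oplus> Var 0"] in \<open>simp add: \<zeta>\<close>)
qed (simp_all only: less_eq_lindenbaum_def less_lindenbaum_def)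

end

lemma interp_lindenbaum: "interp (\<lambda>i. abs_lindenbaum (Var i)) t = abs_lindenbaum t"
  by (induction t)
    (simp_all add: zero_lindenbaum_def one_lindenbaum_def plus_lindenbaum.abs_eq
      times_lindenbaum.abs_eq uminus_lindenbaum.abs_eq)

section \<open>Validity and the totally ordered quotient\<close>

definition valid :: "form \<Rightarrow> bool" where
  "valid t \<longleftrightarrow> (\<forall>x. (\<forall>i. x i \<in> {0..1}) \<longrightarrow> eval x t = 1)"

text \<open>A type cannot depend on a formula, so the chain in which an underivable valid formula would fail
  is built from one filter, chosen once and for all: it omits an underivable valid formula if there
  is one.\<close>

definition chain_filter :: "lindenbaum set" where
  "chain_filter = (SOME F. deductive F \<and> prime F \<and>
     ((\<exists>t. valid t \<and> abs_lindenbaum t \<noteq> 1) \<longrightarrow> (\<exists>t. valid t \<and> abs_lindenbaum t \<notin> F)))"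

lemma chain_filter:
  "deductive chain_filter" "prime chain_filter"
  "valid t \<Longrightarrow> abs_lindenbaum t \<noteq> 1 \<Longrightarrow> \<exists>t. valid t \<and> abs_lindenbaum t \<notin> chain_filter"
proof -
  have "\<exists>F. deductive F \<and> prime F \<and>
     ((\<exists>t. valid t \<and> abs_lindenbaum t \<noteq> 1) \<longrightarrow> (\<exists>t. valid t \<and> abs_lindenbaum t \<notin> F))"
  proof (cases "\<exists>t. valid t \<and> abs_lindenbaum t \<noteq> 1")
    case True
    then show ?thesis using ex_prime_deductive by metis
  next
    case False
    \<comment> \<open>The improper filter will do: its quotient has a single element but is still a
      chain, as the type below must be in either case.\<close>
    moreover have "deductive (UNIV :: lindenbaum set)" "prime (UNIV :: lindenbaum set)"
      by (simp_all add: deductive_def prime_def)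
    ultimately show ?thesis by blast
  qed
  from someI_ex[OF this, folded chain_filter_def]
  show "deductive chain_filter" "prime chain_filter"
    "valid t \<Longrightarrow> abs_lindenbaum t \<noteq> 1 \<Longrightarrow> \<exists>t. valid t \<and> abs_lindenbaum t \<notin> chain_filter" by blast+
qed

quotient_type lindenbaum_chain = lindenbaum / "filter_eq chain_filter"
  by (rule equivp_filter_eq[OF chain_filter(1)])

instantiation lindenbaum_chain :: mv_algebra
begin

lift_definition zero_lindenbaum_chain :: lindenbaum_chain is 0 .
lift_definition one_lindenbaum_chain :: lindenbaum_chain is 1 .
lift_definition plus_lindenbaum_chain :: "lindenbaum_chain \<Rightarrow> lindenbaum_chain \<Rightarrow> lindenbaum_chain" is "(+)"
  by (rule filter_eq_add[OF chain_filter(1)])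
lift_definition times_lindenbaum_chain :: "lindenbaum_chain \<Rightarrow> lindenbaum_chain \<Rightarrow> lindenbaum_chain" is "(*)"
  by (rule filter_eq_mult[OF chain_filter(1)])
lift_definition uminus_lindenbaum_chain :: "lindenbaum_chain \<Rightarrow> lindenbaum_chain" is uminus
  by (rule filter_eq_neg)
definition "x \<le> y \<longleftrightarrow> - x + y = (1 :: lindenbaum_chain)"
definition "x < y \<longleftrightarrow> x \<le> y \<and> \<not> y \<le> (x :: lindenbaum_chain)"

instance
proof
  fix a b c :: lindenbaum_chain
  note refl = filter_eq_refl[OF chain_filter(1)]
  show "a + b = b + a" by transfer (simp add: add.commute refl)
  show "a * b = b * a" by transfer (simp add: mult.commute refl)
  show "a + b + c = a + (b + c)" by transfer (simp add: add.assoc refl)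
  show "a * b * c = a * (b * c)" by transfer (simp add: mult.assoc refl)
  show "0 + a = a" "1 * a = a" "a + 1 = 1" "a + - a = 1" "- (- a) = a" "- 0 = (1 :: lindenbaum_chain)"
    by (transfer, simp add: refl)+
  show "- (a + b) = - a * - b" by transfer (simp only: neg_add refl)
  show "a * - b + b = b * - a + a" by transfer (subst lukasiewicz, rule refl)
qed (simp_all only: less_eq_lindenbaum_chain_def less_lindenbaum_chain_def)

end

instance lindenbaum_chain :: mv_chain
proof
  fix a b :: lindenbaum_chain
  show "a \<le> b \<or> b \<le> a"
    unfolding less_eq_lindenbaum_chain_def
    by transfer (use chain_filter(1,2) in \<open>simp add: filter_eq_one_iff prime_def\<close>)
qed

lemma interp_lindenbaum_chain:
  "interp (\<lambda>i. abs_lindenbaum_chain (abs_lindenbaum (Var i))) t = abs_lindenbaum_chain (abs_lindenbaum t)"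
proof -
  have "interp (\<lambda>i. abs_lindenbaum_chain (v i)) t = abs_lindenbaum_chain (interp v t)" for v
    by (induction t)
      (simp_all add: zero_lindenbaum_chain_def one_lindenbaum_chain_def plus_lindenbaum_chain.abs_eq
        times_lindenbaum_chain.abs_eq uminus_lindenbaum_chain.abs_eq)
  then show ?thesis by (simp only: interp_lindenbaum)
qed

theorem valid_imp_derivable:
  assumes "valid t"
  shows "abs_lindenbaum t = 1"
proof (rule ccontr)
  assume "abs_lindenbaum t \<noteq> 1"
  \<comment> \<open>The filter omits some valid formula \<open>s\<close>, perhaps not
    \<open>t\<close> itself; any such formula leads to the contradiction.\<close>
  then obtain s where s: "valid s" "abs_lindenbaum s \<notin> chain_filter"
    using chain_filter(3) assms by blast
  then have "abs_lindenbaum_chain (abs_lindenbaum s) \<noteq> 1"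
    using filter_eq_one_iff[OF chain_filter(1)]
    by (simp add: one_lindenbaum_chain_def lindenbaum_chain.abs_eq_iff)
  then have "interp (\<lambda>i. abs_lindenbaum_chain (abs_lindenbaum (Var i))) s \<noteq> 1"
    unfolding interp_lindenbaum_chain .
  from chain_counterexample_real[OF this]
  show False using s(1) unfolding valid_def by blast
qed

text \<open>Both implications are valid, hence have class \<open>1\<close>; in the Lindenbaum order
  these are the two inequalities between the classes.\<close>

theorem lukasiewicz_completeness:
  assumes "\<And>x. (\<And>i. x i \<in> {0..1}) \<Longrightarrow> eval x s = eval x t"
  shows "mv_eq s t"
proof -
  have "valid (\<sim> s \<oplus> t)" "valid (\<sim> t \<oplus> s)"
    using assms by (simp_all add: valid_def)
  then have "- abs_lindenbaum s + abs_lindenbaum t = 1" "- abs_lindenbaum t + abs_lindenbaum s = 1"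
    using valid_imp_derivable[of "\<sim> s \<oplus> t"] valid_imp_derivable[of "\<sim> t \<oplus> s"]
    by (simp_all only: plus_lindenbaum.abs_eq uminus_lindenbaum.abs_eq)
  then have "abs_lindenbaum s = abs_lindenbaum t"
    unfolding le_iff_imp[symmetric] by (rule antisym)
  then show ?thesis by (simp only: lindenbaum.abs_eq_iff)
qed

section \<open>Substitution graphs\<close>

text \<open>Valuations here assign values to all variables, so the number of inputs drops out of the
  argument; \<open>truth_fun_eq_iff\<close> restores it.\<close>

definition sem_eq :: "form \<Rightarrow> form \<Rightarrow> bool" where
  "sem_eq s t \<longleftrightarrow> (\<forall>x. (\<forall>i. x i \<in> {0..1}) \<longrightarrow> eval x s = eval x t)"

lemma sem_eq_trans: "sem_eq r s \<Longrightarrow> sem_eq s t \<Longrightarrow> sem_eq r t"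
  by (simp add: sem_eq_def)

lemma truth_fun_eq_iff:
  assumes "in_vars n s" "in_vars n t"
  shows "truth_fun n s = truth_fun n t \<longleftrightarrow> sem_eq s t"
proof
  assume eq: "truth_fun n s = truth_fun n t"
  show "sem_eq s t" unfolding sem_eq_def
  proof (intro allI impI)
    fix x :: "nat \<Rightarrow> real" assume x: "\<forall>i. x i \<in> {0..1}"
    then have "restrict x {..<n} \<in> {..<n} \<rightarrow>\<^sub>E {0..1}" by (simp add: PiE_iff)
    moreover have "eval (restrict x {..<n}) u = eval x u" if "in_vars n u" for u
      using that unfolding in_vars_def by (intro eval_cong) auto
    ultimately have "truth_fun n u (restrict x {..<n}) = eval x u" if "in_vars n u" for u
      using that by (simp add: truth_fun_def)
    from this[OF assms(1)] this[OF assms(2)] show "eval x s = eval x t" unfolding eq by (rule trans[OF sym])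
  qed
next
  assume sem: "sem_eq s t"
  show "truth_fun n s = truth_fun n t" unfolding truth_fun_def
  proof (rule restrict_ext)
    fix x :: "nat \<Rightarrow> real" assume x: "x \<in> {..<n} \<rightarrow>\<^sub>E {0..1}"
    define y where "y i = (if i < n then x i else 0)" for i
    have eq: "eval x u = eval y u" if "in_vars n u" for u
      using that unfolding in_vars_def by (intro eval_cong) (auto simp: y_def)
    have "y i \<in> {0..1}" for i
      using PiE_mem[OF x, of i] by (cases "i < n") (simp_all add: y_def)
    then have "eval y s = eval y t" using sem unfolding sem_eq_def by blast
    then show "eval x s = eval x t" by (simp only: eq[OF assms(1)] eq[OF assms(2)])
  qed
qed

lemma sg_formula_Cons: "R \<noteq> [] \<Longrightarrow> sg_formula (cs # R) = subst (list_subst cs) (sg_formula R)"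
  by (simp add: sg_formula_def)

lemma sg_formula_append_cong:
  "X \<noteq> [] \<Longrightarrow> Y \<noteq> [] \<Longrightarrow> sg_formula X = sg_formula Y \<Longrightarrow> sg_formula (P @ X) = sg_formula (P @ Y)"
  by (induction P) (simp_all add: sg_formula_Cons)

lemma sg_formula_sem_eq:
  assumes "list_all2 (list_all2 sem_eq) G G'" "G \<noteq> []" "[] \<notin> set G"
  shows "sem_eq (sg_formula G) (sg_formula G')"
  using assms
proof (induction rule: list_all2_induct)
  case (Cons cs G ds G')
  show ?case
  proof (cases "G = []")
    case True
    then show ?thesis using Cons by (cases cs) (auto simp: sg_formula_def list_all2_Cons1)
  next
    case False
    then have IH: "sem_eq (sg_formula G) (sg_formula G')" and "G' \<noteq> []" using Cons by auto
    have "eval x (subst (list_subst cs) (sg_formula G)) = eval x (subst (list_subst ds) (sg_formula G'))"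
      if x: "\<forall>i. x i \<in> {0..1}" for x
    proof -
      have "eval x (list_subst cs i) = eval x (list_subst ds i)" for i
        using Cons.hyps(1) x by (auto simp: list_subst_def sem_eq_def list_all2_conv_all_nth)
      \<comment> \<open>Equivalence of the remaining levels speaks only of valuations in the cube,
        so the values of this level have to stay in it.\<close>
      moreover have "eval x (list_subst cs i) \<in> {0..1}" for i using x by (intro eval_in_unit) auto
      ultimately show ?thesis using IH by (simp add: eval_subst sem_eq_def)
    qed
    then show ?thesis using False \<open>G' \<noteq> []\<close> by (simp add: sg_formula_Cons sem_eq_def)
  qed
qed simp

section \<open>The moves and the represented formula\<close>

lemma node_rewrite_sem_eq:
  assumes "is_sgraph G" "node_rewrite MV G G'"
  shows "sem_eq (sg_formula G) (sg_formula G')"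
proof -
  obtain j i t' e where *: "j < length G" "i < length (G ! j)" "e \<in> MV" "deriv_step e (G ! j ! i) t'"
    and G': "G' = G[j := (G ! j)[i := t']]"
    using assms(2) unfolding node_rewrite_def by auto
  have step: "sem_eq (G ! j ! i) t'"
    using deriv_step_sound[OF *(3,4)] by (simp add: sem_eq_def)
  have "list_all2 (list_all2 sem_eq) G G'"
    unfolding G' list_all2_conv_all_nth using *(1,2) step
    by (auto simp: nth_list_update sem_eq_def)
  moreover have "G \<noteq> []" "[] \<notin> set G"
    using assms(1) by (auto simp: is_sgraph_def in_set_conv_nth)
  ultimately show ?thesis by (rule sg_formula_sem_eq)
qed

lemma sgraph_layer_vars:
  "is_sgraph G \<Longrightarrow> Suc m < length G \<Longrightarrow> t \<in> set (G ! Suc m) \<Longrightarrow> in_vars (length (G ! m)) t"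
  unfolding is_sgraph_def by force

lemma sgraph_layer_ne: "is_sgraph G \<Longrightarrow> m < length G \<Longrightarrow> G ! m \<noteq> []"
  by (simp add: is_sgraph_def)

lemma in_vars_sg_formula_drop:
  assumes "is_sgraph G" "Suc m < length G"
  shows "in_vars (length (G ! m)) (sg_formula (drop (Suc m) G))"
  using assms(2)
proof (induction "length G - m" arbitrary: m)
  case (Suc l)
  show ?case
  proof (cases "Suc (Suc m) < length G")
    case True
    then have "sg_formula (drop (Suc m) G) = subst (list_subst (G ! Suc m)) (sg_formula (drop (Suc (Suc m)) G))"
      using Suc.prems by (simp add: Cons_nth_drop_Suc[symmetric] sg_formula_Cons)
    moreover have "in_vars (length (G ! Suc m)) (sg_formula (drop (Suc (Suc m)) G))"
      using Suc True by auto
    ultimately show ?thesis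
      using in_vars_list_subst sgraph_layer_vars[OF assms(1) Suc.prems] by metis
  next
    case False
    then have "drop (Suc m) G = [G ! Suc m]"
      using Suc.prems by (simp add: Cons_nth_drop_Suc[symmetric])
    then have "sg_formula (drop (Suc m) G) = hd (G ! Suc m)" by (simp add: sg_formula_def)
    then show ?thesis
      using sgraph_layer_vars[OF assms(1) Suc.prems] sgraph_layer_ne[OF assms(1) Suc.prems] by simp
  qed
qed simp

lemma list_subst_inputs: "is_sgraph G \<Longrightarrow> list_subst (G ! 0) = Var"
proof
  fix i assume "is_sgraph G"
  then have G: "G ! 0 = map Var [0..<length (G ! 0)]" by (simp add: is_sgraph_def)
  have "(G ! 0) ! i = Var i" if "i < length (G ! 0)"
    by (subst G) (simp add: that)
  then show "list_subst (G ! 0) i = Var i" by (simp add: list_subst_def)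
qed

lemma sg_formula_sgraph:
  assumes "is_sgraph G"
  shows "sg_formula G = sg_formula (drop 1 G)" "in_vars (num_inputs G) (sg_formula G)"
proof -
  have "length G \<ge> 2" using assms by (simp add: is_sgraph_def)
  then obtain cs R where G: "G = cs # R" "R \<noteq> []"
    by (cases G; cases "tl G") auto
  then have "list_subst cs = Var" using list_subst_inputs[OF assms] by simp
  then show "sg_formula G = sg_formula (drop 1 G)"
    using G by (simp add: sg_formula_Cons subst_Var)
  then show "in_vars (num_inputs G) (sg_formula G)"
    using in_vars_sg_formula_drop[OF assms, of 0] \<open>length G \<ge> 2\<close> by (simp add: num_inputs_def)
qed

lemma layer_collapse_sg_formula:
  assumes "is_sgraph G" "layer_collapse G G'"
  shows "sg_formula G' = sg_formula G"
proof -
  obtain k where k: "1 \<le> k" "k + 1 < length G"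
    and G': "G' = take k G @ [map (subst (list_subst (G ! k))) (G ! (k + 1))] @ drop (k + 2) G"
    using assms(2) unfolding layer_collapse_def by auto
  let ?A = "G ! k" and ?B = "G ! (k + 1)" and ?R = "drop (k + 2) G"
  have G: "G = take k G @ (?A # ?B # ?R)"
    using k by (simp add: Cons_nth_drop_Suc)
  have "sg_formula (map (subst (list_subst ?A)) ?B # ?R) = sg_formula (?A # ?B # ?R)"
  proof (cases "?R = []")
    case True
    then show ?thesis
      using sgraph_layer_ne[OF assms(1), of "k + 1"] k by (simp add: sg_formula_def list.map_sel)
  next
    case False
    \<comment> \<open>\<open>list_subst\<close> fixes the variables beyond its list, so the
      successive substitutions and the composite one need agree only on the variables of level
      \<open>k + 1\<close>.\<close>
    then have "in_vars (length ?B) (sg_formula ?R)"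
      using in_vars_sg_formula_drop[OF assms(1), of "k + 1"] by simp
    then have "subst (list_subst (map (subst (list_subst ?A)) ?B)) (sg_formula ?R)
      = subst (list_subst ?A) (subst (list_subst ?B) (sg_formula ?R))"
      unfolding subst_subst by (intro subst_cong) (auto simp: list_subst_def in_vars_def)
    then show ?thesis using False by (simp add: sg_formula_Cons)
  qed
  then have "sg_formula (take k G @ (map (subst (list_subst ?A)) ?B # ?R))
      = sg_formula (take k G @ (?A # ?B # ?R))"
    by (intro sg_formula_append_cong) simp_all
  then show ?thesis using G G' by simp
qed

lemma layer_expansion_imp_collapse:
  assumes "layer_expansion G G'"
  shows "layer_collapse G' G"
proof -
  obtain k cs ts where k: "1 \<le> k" "k < length G"
    and eq: "map (subst (list_subst cs)) ts = G ! k"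
    and G': "G' = take k G @ [cs, ts] @ drop (k + 1) G"
    using assms unfolding layer_expansion_def by auto
  have G'_nth: "G' ! k = cs" "G' ! (k + 1) = ts"
    and G'_parts: "take k G' = take k G" "drop (k + 2) G' = drop (k + 1) G"
    using k by (simp_all add: G' nth_append)
  have "G = take k G' @ [map (subst (list_subst (G' ! k))) (G' ! (k + 1))] @ drop (k + 2) G'"
    unfolding G'_nth G'_parts eq using id_take_nth_drop[OF k(2)] by simp
  moreover have "k + 1 < length G'" using k by (simp add: G')
  ultimately show ?thesis unfolding layer_collapse_def using k(1) by blast
qed

text \<open>The removed level and the old formulae above it are the free choices of the expansion;
  well-formedness of \<open>G\<close> provides its side conditions.\<close>

lemma layer_collapse_imp_expansion:
  assumes "is_sgraph G" "layer_collapse G G'"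
  shows "layer_expansion G' G"
proof -
  obtain k where k: "1 \<le> k" "k + 1 < length G"
    and G': "G' = take k G @ [map (subst (list_subst (G ! k))) (G ! (k + 1))] @ drop (k + 2) G"
    using assms(2) unfolding layer_collapse_def by auto
  let ?cs = "G ! k" and ?ts = "G ! (k + 1)"
  have G'_nth: "G' ! k = map (subst (list_subst ?cs)) ?ts" "G' ! (k - 1) = G ! (k - 1)"
    and G'_parts: "take k G' = take k G" "drop (k + 1) G' = drop (k + 2) G"
    and "k < length G'"
    using k by (simp_all add: G' nth_append)
  have "G = take k G' @ [?cs, ?ts] @ drop (k + 1) G'"
    unfolding G'_parts using k by (simp add: Cons_nth_drop_Suc)
  moreover have "?cs \<noteq> []" using sgraph_layer_ne[OF assms(1)] k by simp
  moreover have "\<forall>c\<in>set ?cs. in_vars (length (G' ! (k - 1))) c"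
    unfolding G'_nth using sgraph_layer_vars[OF assms(1), of "k - 1"] k by simp
  moreover have "\<forall>t\<in>set ?ts. in_vars (length ?cs) t"
    using sgraph_layer_vars[OF assms(1), of k] k by simp
  moreover have "k \<in> {1..<length G'}" using k \<open>k < length G'\<close> by simp
  ultimately show ?thesis unfolding layer_expansion_def using G'_nth(1) by metis
qed

lemma sg_move_is_sgraph:
  "is_sgraph G \<Longrightarrow> sg_move MV G G' \<Longrightarrow> is_sgraph G' \<and> num_inputs G' = num_inputs G"
  unfolding sg_move_def
  using node_rewrite_is_sgraph layer_collapse_is_sgraph layer_expansion_is_sgraph by blast

lemma sg_move_sem_eq:
  assumes "is_sgraph G" "sg_move MV G G'"
  shows "sem_eq (sg_formula G) (sg_formula G')"
proof -
  have "sem_eq (sg_formula G) (sg_formula G')" if "layer_expansion G G'"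
    using layer_collapse_sg_formula[OF _ layer_expansion_imp_collapse[OF that]]
      layer_expansion_is_sgraph[OF assms(1) that] by (simp add: sem_eq_def)
  then show ?thesis
    using assms node_rewrite_sem_eq layer_collapse_sg_formula unfolding sg_move_def
    by (auto simp: sem_eq_def)
qed

lemma sg_moves_sem_eq:
  assumes "(sg_move MV)\<^sup>*\<^sup>* G G'" "is_sgraph G"
  shows "sem_eq (sg_formula G) (sg_formula G')"
proof -
  have "is_sgraph G' \<and> sem_eq (sg_formula G) (sg_formula G')"
    using assms(1)
  proof (induction rule: rtranclp_induct)
    case (step H H')
    then show ?case using sg_move_is_sgraph sg_move_sem_eq sem_eq_trans by blast
  qed (simp add: assms sem_eq_def)
  then show ?thesis ..
qed

section \<open>Graphs of depth 1\<close>

definition shallow_sgraph :: "nat \<Rightarrow> form \<Rightarrow> sgraph" where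
  "shallow_sgraph n t = [map Var [0..<n], [t]]"

text \<open>Both directions are carried through the induction because the final path descends from
  one graph to depth 1, rewrites there, and climbs up to the other graph.\<close>

lemma shallow_sgraph_connected:
  assumes "is_sgraph G"
  shows "(sg_move MV)\<^sup>*\<^sup>* G (shallow_sgraph (num_inputs G) (sg_formula G)) \<and>
    (sg_move MV)\<^sup>*\<^sup>* (shallow_sgraph (num_inputs G) (sg_formula G)) G"
  using assms
proof (induction "length G" arbitrary: G rule: less_induct)
  case less
  show ?case
  proof (cases "length G = 2")
    case True
    then obtain A B where G: "G = [A, B]"
      by (auto simp: numeral_2_eq_2 length_Suc_conv)
    moreover from this obtain t where "B = [t]"
      using less.prems by (auto simp: is_sgraph_def length_Suc_conv)
    moreover have "A = map Var [0..<length A]" using less.prems G by (simp add: is_sgraph_def)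
    moreover have "sg_formula G = sg_formula (drop 1 G)" using sg_formula_sgraph less.prems by blast
    ultimately have "shallow_sgraph (num_inputs G) (sg_formula G) = G"
      by (simp add: shallow_sgraph_def num_inputs_def sg_formula_def)
    then show ?thesis by simp
  next
    case False
    then have len: "length G > 2" using less.prems by (auto simp: is_sgraph_def)
    define H where "H = take 1 G @ [map (subst (list_subst (G ! 1))) (G ! (1 + 1))] @ drop (1 + 2) G"
    have coll: "layer_collapse G H"
      unfolding layer_collapse_def H_def using len by (intro exI[of _ 1]) simp
    have "length H < length G" using len by (simp add: H_def)
    moreover have "is_sgraph H" "num_inputs H = num_inputs G"
      using layer_collapse_is_sgraph[OF less.prems coll] by simp_all
    moreover have "sg_formula H = sg_formula G"
      by (rule layer_collapse_sg_formula[OF less.prems coll])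
    moreover have "sg_move MV G H" "sg_move MV H G"
      using coll layer_collapse_imp_expansion[OF less.prems coll] by (simp_all add: sg_move_def)
    ultimately show ?thesis
      using less.hyps[of H] by (metis converse_rtranclp_into_rtranclp rtranclp.rtrancl_into_rtrancl)
  qed
qed

lemma shallow_sgraph_rewrite:
  assumes "mv_step s t" "in_vars n t"
  shows "sg_move MV (shallow_sgraph n s) (shallow_sgraph n t)"
proof -
  have "node_rewrite MV (shallow_sgraph n s) (shallow_sgraph n t)"
    unfolding node_rewrite_def using assms
    by (intro bexI[of _ 1] exI[of _ 0]) (auto simp: shallow_sgraph_def mv_step_def)
  then show ?thesis by (simp add: sg_move_def)
qed

text \<open>A derivation may pass through variables beyond the inputs; they are replaced by \<open>\<zero>\<close>.\<close>

lemma shallow_sgraph_derivation: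
  assumes "mv_eq s t" "in_vars n s" "in_vars n t"
  shows "(sg_move MV)\<^sup>*\<^sup>* (shallow_sgraph n s) (shallow_sgraph n t)"
proof -
  define \<sigma> where "\<sigma> i = (if i < n then Var i else \<zero>)" for i
  have vars: "in_vars n (subst \<sigma> u)" for u
    by (induction u) (auto simp: in_vars_def \<sigma>_def)
  have "(sg_move MV)\<^sup>*\<^sup>* (shallow_sgraph n (subst \<sigma> s)) (shallow_sgraph n (subst \<sigma> t))"
    using assms(1)
  proof (induction rule: rtranclp_induct)
    case (step u u')
    then show ?case
      using shallow_sgraph_rewrite[OF mv_step_subst vars] by (meson rtranclp.rtrancl_into_rtrancl)
  qed simp
  moreover have "subst \<sigma> u = u" if "in_vars n u" for u
  proof -
    have "subst \<sigma> u = subst Var u"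
      using that unfolding in_vars_def by (intro subst_cong) (auto simp: \<sigma>_def)
    then show ?thesis by (simp only: subst_Var)
  qed
  ultimately show ?thesis using assms by simp
qed

theorem theorem4:
  fixes G G' :: sgraph
  assumes "is_sgraph G" and "is_sgraph G'"
    and "num_inputs G = num_inputs G'"
  shows "sg_fun G = sg_fun G' \<longleftrightarrow> (sg_move MV)\<^sup>*\<^sup>* G G'"
proof -
  have vars: "in_vars (num_inputs G) (sg_formula G)" "in_vars (num_inputs G) (sg_formula G')"
    using sg_formula_sgraph assms by metis+
  have "sg_fun G = sg_fun G' \<longleftrightarrow> sem_eq (sg_formula G) (sg_formula G')"
    unfolding sg_fun_def assms(3)[symmetric] by (rule truth_fun_eq_iff[OF vars])
  also have "\<dots> \<longleftrightarrow> (sg_move MV)\<^sup>*\<^sup>* G G'"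
  proof
    assume "sem_eq (sg_formula G) (sg_formula G')"
    then have "mv_eq (sg_formula G) (sg_formula G')"
      by (intro lukasiewicz_completeness) (simp add: sem_eq_def)
    from shallow_sgraph_derivation[OF this vars] show "(sg_move MV)\<^sup>*\<^sup>* G G'"
      using shallow_sgraph_connected[OF assms(1)] shallow_sgraph_connected[OF assms(2)] assms(3)
      by (metis rtranclp_trans)
  qed (rule sg_moves_sem_eq[OF _ assms(1)])
  finally show ?thesis .
qed

end
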